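(* There is an algorithm which, given as input the list $P\cap\mathbb{Z}^3$ of all lattice points of a lattice polytope $P\subset\mathbb{R}^3$, computes the Minkowski length $L(P)$ in time polynomial in the size of $P\cap\mathbb{Z}^3$.
   Context: A lattice polytope in $\mathbb{R}^n$ is the convex hull of a finite non-empty set of points of $\mathbb{Z}^n$; it is non-trivial if it is not a single point. A lattice segment is primitive if its only lattice points are its two endpoints. The Minkowski sum of $P,Q\subset\mathbb{R}^n$ is $P+Q=\{p+q : p\in P, q\in Q\}$. The Minkowski length $L(P)$ of a lattice polytope $P\subset\mathbb{R}^n$ is the largest number $L$ of primitive lattice segments $E_1,\dots,E_L$ in $\mathbb{R}^n$ (not necessarily distinct) such that $E_1+\cdots+E_L\subseteq P$; equivalently, it is the largest number of non-trivial lattice polytopes whose Minkowski sum is contained in $P$. *)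

theory Defs
  imports
    "HOL-Analysis.Analysis"
    "HOL-Library.Set_Algebras"
    "HOL-Computational_Algebra.Polynomial"
begin

section \<open>Lattice polytopes and Minkowski length\<close>

definition int_lattice :: "(real ^ 'n) set" where
  "int_lattice = {x. \<forall>i. x $ i \<in> \<int>}"

definition lattice_polytope :: "(real ^ 'n) set \<Rightarrow> bool" where
  "lattice_polytope P \<longleftrightarrow>
     (\<exists>S. finite S \<and> S \<noteq> {} \<and> S \<subseteq> int_lattice \<and> P = convex hull S)"

definition primitive_segment :: "(real ^ 'n) set \<Rightarrow> bool" where
  "primitive_segment E \<longleftrightarrow>
     (\<exists>a b. a \<in> int_lattice \<and> b \<in> int_lattice \<and> a \<noteq> b \<and>
        E = closed_segment a b \<and> E \<inter> int_lattice = {a, b})"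

text \<open>
  The sum over sets below is the Minkowski sum of \<^theory>\<open>HOL-Library.Set_Algebras\<close>.
  The value \<open>L = 0\<close> is always admitted: the empty Minkowski sum is \<open>{0}\<close>, which need not lie
  in \<open>P\<close>, whereas a polytope without primitive lattice segments (a single point) has length 0.
\<close>
definition minkowski_length :: "(real ^ 'n) set \<Rightarrow> nat" where
  "minkowski_length P = (GREATEST L. L = 0 \<or>
     (\<exists>E :: nat \<Rightarrow> (real ^ 'n) set.
        (\<forall>i<L. primitive_segment (E i)) \<and> (\<Sum>i<L. E i) \<subseteq> P))"


section \<open>Algorithms: random access machines\<close>

text \<open>
  The random access machine of Cook and Reckhow (Time bounded random access machines, 1973), with
  its instruction set: registers hold integers and are indexed by the natural numbers, and
  arithmetic consists of addition and subtraction only. Time is the number of executed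
  instructions. As there is no multiplication, the bit length of register contents grows by at most
  one per step beyond that of the input and the program constants, so polynomially many steps also
  mean polynomial time in the bit model.
\<close>

datatype instr =
    SET nat int
  | ADD nat nat nat
  | SUB nat nat nat
  | LOAD nat nat
  | STORE nat nat
  | JPOS nat nat
  | READ nat
  | PRINT nat

record ram_state =
  pc :: nat
  reg :: "nat \<Rightarrow> int"
  inp :: "int list"
  outp :: "int list"

definition set_reg :: "nat \<Rightarrow> int \<Rightarrow> ram_state \<Rightarrow> ram_state" where
  "set_reg i v s = s\<lparr>pc := Suc (pc s), reg := (reg s)(i := v)\<rparr>"

text \<open>
  The result \<^const>\<open>None\<close> is a fault: an indirect access to a negative address or reading
  from an exhausted input.
\<close>
fun exec_instr :: "instr \<Rightarrow> ram_state \<Rightarrow> ram_state option" where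
  "exec_instr (SET i c) s = Some (set_reg i c s)"
| "exec_instr (ADD i j k) s = Some (set_reg i (reg s j + reg s k) s)"
| "exec_instr (SUB i j k) s = Some (set_reg i (reg s j - reg s k) s)"
| "exec_instr (LOAD i j) s =
     (if reg s j < 0 then None else Some (set_reg i (reg s (nat (reg s j))) s))"
| "exec_instr (STORE i j) s =
     (if reg s i < 0 then None else Some (set_reg (nat (reg s i)) (reg s j) s))"
| "exec_instr (JPOS j m) s =
     Some (s\<lparr>pc := (if reg s j > 0 then m else Suc (pc s))\<rparr>)"
| "exec_instr (READ i) s =
     (case inp s of [] \<Rightarrow> None | v # vs \<Rightarrow> Some (set_reg i v (s\<lparr>inp := vs\<rparr>)))"
| "exec_instr (PRINT i) s =
     Some (s\<lparr>pc := Suc (pc s), outp := outp s @ [reg s i]\<rparr>)"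

definition ram_step :: "instr list \<Rightarrow> ram_state \<Rightarrow> ram_state \<Rightarrow> bool" where
  "ram_step prog s s' \<longleftrightarrow>
     pc s < length prog \<and> exec_instr (prog ! pc s) s = Some s'"

definition ram_init :: "int list \<Rightarrow> ram_state" where
  "ram_init xs = \<lparr>pc = 0, reg = (\<lambda>_. 0), inp = xs, outp = []\<rparr>"

text \<open>
  A computation halts when the program counter leaves the program; a faulting one does not halt.
\<close>
definition ram_computes_within ::
  "instr list \<Rightarrow> int list \<Rightarrow> int list \<Rightarrow> nat \<Rightarrow> bool" where
  "ram_computes_within prog xs ys T \<longleftrightarrow>
     (\<exists>t s. t \<le> T \<and> (ram_step prog ^^ t) (ram_init xs) s \<and>
        length prog \<le> pc s \<and> outp s = ys)"


text \<open>
  The input word: the number of points, then their coordinates point by point. The coordinates of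
  lattice points are integers, so the floor only changes their type.
\<close>
definition encode_points :: "(real ^ 3) list \<Rightarrow> int list" where
  "encode_points pts =
     int (length pts) # concat (map (\<lambda>x. [\<lfloor>x $ 1\<rfloor>, \<lfloor>x $ 2\<rfloor>, \<lfloor>x $ 3\<rfloor>]) pts)"

end

theory Submission
  imports Defs
begin

text \<open>
  Take a longest Minkowski sum of lattice segments in \<open>P\<close> for which the sum of the squared lengths of
  the segments is minimal. If two direction vectors \<open>v \<noteq> w\<close> (lexicographically positive) were congruent
  modulo 2, both segments could be replaced by the segment along \<open>(v + w) / 2\<close>, a contradiction. So at
  most 8 directions occur, and \<open>L(P)\<close> is the maximum of \<open>n\<^sub>1 + \<dots> + n\<^sub>8\<close> over all lattice points
  \<open>z\<close>, \<open>p\<^sub>1\<close>, \<dots>, \<open>p\<^sub>8\<close> of \<open>P\<close> and all \<open>n\<^sub>j < |P \<inter> \<int>\<^sup>3|\<close> such that the \<open>2\<^sup>8\<close> vertices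
  \<open>z + (\<Sum>j\<in>J. n\<^sub>j (p\<^sub>j - z))\<close> lie in \<open>P\<close>; the \<open>n\<^sub>j\<close> with \<open>p\<^sub>j = z\<close> are not counted. A random access
  machine can search through all these choices: membership of the vertices is looked up in the list
  of lattice points, and the multiples \<open>n\<^sub>j (p\<^sub>j - z)\<close> are built up by repeated addition.
\<close>

section \<open>A structured language for random access machines\<close>

text \<open>The number of segments in a sum grows with \<open>P\<close>, so trying all tuples of
  directions would not be polynomial; a bound on the number of directions that is independent of
  \<open>P\<close> makes exhaustive search affordable. The 8 is the number of residue classes of
  \<int>^3 modulo 2. The class of 0 has to be counted, because \<open>(v + w) / 2\<close> may fail
  to be primitive, so the exchange argument works with arbitrary non-zero lattice vectors. The bound
  on n_j comes from the n_j + 1 distinct lattice points z, z + u_j, ..., z + n_j u_j of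
  \<open>P\<close>. Conversely, the search does not have to recognise primitive or distinct
  directions: any hit with count L > 0 yields L non-trivial lattice segments, and each can be
  shortened to a primitive one. With N lattice points there are N choices of z and N^16 choices of
  the pairs (p_j, n_j), each followed by 2^8 lookups of cost O(N); the number of steps is of order
  N^18.\<close>

datatype com =
    Block "instr list"
  | Seq com com
  | Unless nat com
  | DoWhile com nat

fun csize :: "com \<Rightarrow> nat" where
  "csize (Block is) = length is"
| "csize (Seq c d) = csize c + csize d"
| "csize (Unless r c) = Suc (csize c)"
| "csize (DoWhile c r) = Suc (csize c)"

text \<open>Jump targets of \<open>JPOS\<close> are absolute, hence the start address as a second
  argument.\<close>

fun compile :: "com \<Rightarrow> nat \<Rightarrow> instr list" where
  "compile (Block is) a = is"
| "compile (Seq c d) a = compile c a @ compile d (a + csize c)"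
| "compile (Unless r c) a = JPOS r (Suc a + csize c) # compile c (Suc a)"
| "compile (DoWhile c r) a = compile c a @ [JPOS r a]"

lemma length_compile [simp]: "length (compile c a) = csize c"
  by (induction c arbitrary: a) auto

section \<open>Timed correctness statements for compiled code\<close>

type_synonym store = "(nat \<Rightarrow> int) \<times> int list \<times> int list"

definition at_pc :: "nat \<Rightarrow> store \<Rightarrow> ram_state" where
  "at_pc a \<sigma> = \<lparr>pc = a, reg = fst \<sigma>, inp = fst (snd \<sigma>), outp = snd (snd \<sigma>)\<rparr>"

definition code_at :: "instr list \<Rightarrow> nat \<Rightarrow> instr list \<Rightarrow> bool" where
  "code_at prog a xs \<longleftrightarrow> (\<exists>us vs. prog = us @ xs @ vs \<and> length us = a)"

lemma code_at_append:
  "code_at prog a (xs @ ys) \<longleftrightarrow> code_at prog a xs \<and> code_at prog (a + length xs) ys"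
proof
  assume "code_at prog a (xs @ ys)"
  then obtain us vs where "prog = us @ xs @ ys @ vs" "length us = a"
    by (auto simp: code_at_def)
  then show "code_at prog a xs \<and> code_at prog (a + length xs) ys"
    unfolding code_at_def
    by (metis append.assoc length_append)
next
  assume "code_at prog a xs \<and> code_at prog (a + length xs) ys"
  then have "code_at prog a xs" "code_at prog (a + length xs) ys" by auto
  from this(1) obtain us vs where 1: "prog = us @ xs @ vs" "length us = a"
    unfolding code_at_def by blast
  from \<open>code_at prog (a + length xs) ys\<close>
  obtain us' vs' where 2: "prog = us' @ ys @ vs'" "length us' = a + length xs"
    unfolding code_at_def by blast
  note * = 1 2
  then have "us' = us @ xs"
    using append_eq_append_conv[of us' "us @ xs" "ys @ vs'" vs] by simp
  with * show "code_at prog a (xs @ ys)"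
    unfolding code_at_def by (intro exI[of _ us] exI[of _ vs']) simp
qed

lemma code_at_Cons:
  "code_at prog a (x # xs) \<longleftrightarrow> a < length prog \<and> prog ! a = x \<and> code_at prog (Suc a) xs"
proof -
  have "code_at prog a [x] \<longleftrightarrow> a < length prog \<and> prog ! a = x"
    unfolding code_at_def
    by (auto simp: nth_append) (metis id_take_nth_drop length_take min.absorb4)
  with code_at_append[of prog a "[x]" xs] show ?thesis by simp
qed

text \<open>A total-correctness triple with a step bound, for one initial store. It quantifies over
  every program that contains the compiled code at some address, so that statements about parts
  combine to statements about the whole.\<close>

definition run :: "com \<Rightarrow> nat \<Rightarrow> store \<Rightarrow> (store \<Rightarrow> bool) \<Rightarrow> bool" where
  "run c T \<sigma> Q \<longleftrightarrow> (\<forall>prog a. code_at prog a (compile c a) \<longrightarrow>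
     (\<exists>t \<sigma>'. t \<le> T \<and> (ram_step prog ^^ t) (at_pc a \<sigma>) (at_pc (a + csize c) \<sigma>') \<and> Q \<sigma>'))"

lemma runI:
  assumes "\<And>prog a. code_at prog a (compile c a) \<Longrightarrow>
     \<exists>t \<sigma>'. t \<le> T \<and> (ram_step prog ^^ t) (at_pc a \<sigma>) (at_pc (a + csize c) \<sigma>') \<and> Q \<sigma>'"
  shows "run c T \<sigma> Q"
  using assms unfolding run_def by blast

lemma runE:
  assumes "run c T \<sigma> Q" "code_at prog a (compile c a)"
  obtains t \<sigma>' where "t \<le> T" "(ram_step prog ^^ t) (at_pc a \<sigma>) (at_pc (a + csize c) \<sigma>')" "Q \<sigma>'"
  using assms unfolding run_def by blast

lemma run_mono:
  assumes "run c T \<sigma> Q" "\<And>\<sigma>'. Q \<sigma>' \<Longrightarrow> Q' \<sigma>'" "T \<le> T'"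
  shows "run c T' \<sigma> Q'"
  using assms unfolding run_def by (meson order_trans)

lemma run_Seq:
  assumes "run c T \<sigma> R" "\<And>\<sigma>'. R \<sigma>' \<Longrightarrow> run d U \<sigma>' Q"
  shows "run (Seq c d) (T + U) \<sigma> Q"
proof (rule runI)
  fix prog a assume "code_at prog a (compile (Seq c d) a)"
  then have c: "code_at prog a (compile c a)" and d: "code_at prog (a + csize c) (compile d (a + csize c))"
    by (auto simp: code_at_append)
  obtain t \<sigma>' where t: "t \<le> T" "(ram_step prog ^^ t) (at_pc a \<sigma>) (at_pc (a + csize c) \<sigma>')" "R \<sigma>'"
    using runE[OF assms(1) c] .
  obtain u \<sigma>'' where u: "u \<le> U"
    "(ram_step prog ^^ u) (at_pc (a + csize c) \<sigma>') (at_pc (a + csize c + csize d) \<sigma>'')" "Q \<sigma>''"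
    using runE[OF assms(2)[OF t(3)] d] .
  have "(ram_step prog ^^ (t + u)) (at_pc a \<sigma>) (at_pc (a + csize c + csize d) \<sigma>'')"
    using t(2) u(2) by (auto simp: relpowp_add)
  then show "\<exists>t \<sigma>'. t \<le> T + U \<and>
      (ram_step prog ^^ t) (at_pc a \<sigma>) (at_pc (a + csize (Seq c d)) \<sigma>') \<and> Q \<sigma>'"
    using t(1) u(1,3) by (intro exI[of _ "t + u"] exI[of _ \<sigma>'']) (auto simp: add.assoc)
qed

lemma ram_step_JPOS:
  assumes "a < length prog" "prog ! a = JPOS r m"
  shows "ram_step prog (at_pc a (f, io)) (at_pc (if f r > 0 then m else Suc a) (f, io))"
  using assms by (simp add: ram_step_def at_pc_def)

lemma run_Unless:
  assumes "fst \<sigma> r > 0 \<Longrightarrow> Q \<sigma>" "fst \<sigma> r \<le> 0 \<Longrightarrow> run c T \<sigma> Q"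
  shows "run (Unless r c) (Suc T) \<sigma> Q"
proof (rule runI)
  fix prog a assume "code_at prog a (compile (Unless r c) a)"
  then have *: "a < length prog" "prog ! a = JPOS r (Suc a + csize c)"
    and c: "code_at prog (Suc a) (compile c (Suc a))"
    by (auto simp: code_at_Cons)
  obtain f io where s: "\<sigma> = (f, io)" by (rule prod.exhaust)
  note step = ram_step_JPOS[OF *, of f io]
  show "\<exists>t \<sigma>'. t \<le> Suc T \<and>
      (ram_step prog ^^ t) (at_pc a \<sigma>) (at_pc (a + csize (Unless r c)) \<sigma>') \<and> Q \<sigma>'"
  proof (cases "f r > 0")
    case True
    then show ?thesis using step assms(1) s
      by (intro exI[of _ 1] exI[of _ \<sigma>]) auto
  next
    case False
    then have "run c T \<sigma> Q" using assms(2) s by auto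
    from runE[OF this c] obtain t \<sigma>' where t: "t \<le> T"
      "(ram_step prog ^^ t) (at_pc (Suc a) \<sigma>) (at_pc (Suc a + csize c) \<sigma>')" "Q \<sigma>'" .
    have "(ram_step prog ^^ Suc t) (at_pc a \<sigma>) (at_pc (Suc a + csize c) \<sigma>')"
      using step t(2) False s by (intro relpowp_Suc_I2) auto
    then show ?thesis using t(1,3)
      by (intro exI[of _ "Suc t"] exI[of _ \<sigma>']) (auto simp del: relpowp.simps split_paired_Ex)
  qed
qed

text \<open>The invariant is indexed by the number of completed passes, and the loop register has to
  be positive exactly while passes remain. Each pass costs one extra step for the backward
  jump.\<close>

lemma run_DoWhile:
  assumes init: "I 0 \<sigma>" and n: "n > 0"
    and body: "\<And>i \<sigma>. i < n \<Longrightarrow> I i \<sigma> \<Longrightarrow>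
      run c T \<sigma> (\<lambda>\<sigma>'. I (Suc i) \<sigma>' \<and> (fst \<sigma>' r > 0 \<longleftrightarrow> Suc i < n))"
    and final: "\<And>\<sigma>. I n \<sigma> \<Longrightarrow> Q \<sigma>"
  shows "run (DoWhile c r) (n * Suc T) \<sigma> Q"
proof (rule runI)
  fix prog a assume "code_at prog a (compile (DoWhile c r) a)"
  then have c: "code_at prog a (compile c a)"
    and j: "a + csize c < length prog" "prog ! (a + csize c) = JPOS r a"
    by (auto simp: code_at_append code_at_Cons)
  \<comment> \<open>Generalised to \<open>m\<close> remaining passes, for the induction on
    \<open>m\<close>.\<close>
  have "\<exists>t \<sigma>'. t \<le> m * Suc T \<and>
      (ram_step prog ^^ t) (at_pc a \<sigma>) (at_pc (Suc a + csize c) \<sigma>') \<and> I n \<sigma>'"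
    if "m > 0" "i + m = n" "I i \<sigma>" for m i \<sigma>
    using that
  proof (induction m arbitrary: i \<sigma>)
    case 0
    then show ?case by simp
  next
    case (Suc m)
    then have "i < n" by simp
    from runE[OF body[OF this Suc.prems(3)] c] obtain t f io where t: "t \<le> T"
      "(ram_step prog ^^ t) (at_pc a \<sigma>) (at_pc (a + csize c) (f, io))"
      "I (Suc i) (f, io)" "f r > 0 \<longleftrightarrow> Suc i < n"
      by (metis fst_conv surj_pair)
    have step: "(ram_step prog ^^ Suc t) (at_pc a \<sigma>)
        (at_pc (if f r > 0 then a else Suc (a + csize c)) (f, io))"
      using ram_step_JPOS[OF j, of f io] t(2) by auto
    show ?case
    proof (cases "m = 0")
      case True
      then show ?thesis using step t Suc.prems
        by (intro exI[of _ "Suc t"] exI[of _ "(f, io)"]) (auto simp del: relpowp.simps split_paired_Ex)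
    next
      case False
      with Suc.IH[OF _ _ t(3)] Suc.prems obtain u \<sigma>' where u: "u \<le> m * Suc T"
        "(ram_step prog ^^ u) (at_pc a (f, io)) (at_pc (Suc a + csize c) \<sigma>')" "I n \<sigma>'"
        by auto
      have "f r > 0" using t(4) Suc.prems False by simp
      with step u(2) have "(ram_step prog ^^ (Suc t + u)) (at_pc a \<sigma>) (at_pc (Suc a + csize c) \<sigma>')"
        unfolding relpowp_add by auto
      then show ?thesis using t(1) u(1,3)
        by (intro exI[of _ "Suc t + u"] exI[of _ \<sigma>']) (auto simp del: relpowp.simps split_paired_Ex)
    qed
  qed
  from this[OF n _ init] final
  show "\<exists>t \<sigma>'. t \<le> n * Suc T \<and>
      (ram_step prog ^^ t) (at_pc a \<sigma>) (at_pc (a + csize (DoWhile c r)) \<sigma>') \<and> Q \<sigma>'"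
    by (fastforce simp del: split_paired_Ex)
qed

text \<open>Weakest preconditions of straight-line code as a recursive function, so that the
  simplifier executes blocks symbolically. Jumps and faults get \<open>False\<close>.\<close>

fun eff :: "instr list \<Rightarrow> store \<Rightarrow> (store \<Rightarrow> bool) \<Rightarrow> bool" where
  "eff [] \<sigma> Q = Q \<sigma>"
| "eff (SET i c # xs) (f, io) Q = eff xs (f(i := c), io) Q"
| "eff (ADD i j k # xs) (f, io) Q = eff xs (f(i := f j + f k), io) Q"
| "eff (SUB i j k # xs) (f, io) Q = eff xs (f(i := f j - f k), io) Q"
| "eff (LOAD i j # xs) (f, io) Q = (0 \<le> f j \<and> eff xs (f(i := f (nat (f j))), io) Q)"
| "eff (STORE i j # xs) (f, io) Q = (0 \<le> f i \<and> eff xs (f(nat (f i) := f j), io) Q)"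
| "eff (JPOS j m # xs) (f, io) Q = False"
| "eff (READ i # xs) (f, [], os) Q = False"
| "eff (READ i # xs) (f, v # vs, os) Q = eff xs (f(i := v), vs, os) Q"
| "eff (PRINT i # xs) (f, is, os) Q = eff xs (f, is, os @ [f i]) Q"

lemma eff_step:
  assumes "eff (x # xs) \<sigma> Q" "a < length prog" "prog ! a = x"
  shows "\<exists>\<sigma>'. ram_step prog (at_pc a \<sigma>) (at_pc (Suc a) \<sigma>') \<and> eff xs \<sigma>' Q"
  using assms(1)
  by (induction "x # xs" \<sigma> Q rule: eff.induct)
    (use assms(2,3) in \<open>auto simp: ram_step_def set_reg_def at_pc_def\<close>)

lemma run_Block:
  assumes "eff xs \<sigma> Q" "length xs \<le> T"
  shows "run (Block xs) T \<sigma> Q"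
proof (rule runI)
  fix prog a assume "code_at prog a (compile (Block xs) a)"
  then have "code_at prog a xs" by simp
  with assms(1) have "\<exists>\<sigma>'. (ram_step prog ^^ length xs) (at_pc a \<sigma>) (at_pc (a + length xs) \<sigma>') \<and> Q \<sigma>'"
  proof (induction xs arbitrary: a \<sigma>)
    case Nil
    then show ?case by (intro exI[of _ \<sigma>]) auto
  next
    case (Cons x xs)
    then obtain \<sigma>' where s: "ram_step prog (at_pc a \<sigma>) (at_pc (Suc a) \<sigma>')" "eff xs \<sigma>' Q"
      using eff_step code_at_Cons by metis
    from Cons.IH[OF s(2), of "Suc a"] Cons.prems(2) obtain \<sigma>'' where
      "(ram_step prog ^^ length xs) (at_pc (Suc a) \<sigma>') (at_pc (Suc a + length xs) \<sigma>'')" "Q \<sigma>''"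
      by (auto simp: code_at_Cons)
    with relpowp_Suc_I2[of "ram_step prog", OF s(1) this(1)] show ?case
      by (intro exI[of _ \<sigma>'']) (auto simp del: relpowp.simps split_paired_Ex)
  qed
  with assms(2) show "\<exists>t \<sigma>'. t \<le> T \<and>
      (ram_step prog ^^ t) (at_pc a \<sigma>) (at_pc (a + csize (Block xs)) \<sigma>') \<and> Q \<sigma>'"
    by auto
qed

lemma run_computes:
  assumes "run c T (\<lambda>_. 0, xs, []) (\<lambda>(f, i, p). p = ys)"
  shows "ram_computes_within (compile c 0) xs ys T"
proof -
  have "code_at (compile c 0) 0 (compile c 0)" by (auto simp: code_at_def)
  from runE[OF assms this] obtain t \<sigma>' where
    t: "t \<le> T" "(ram_step (compile c 0) ^^ t) (at_pc 0 (\<lambda>_. 0, xs, [])) (at_pc (0 + csize c) \<sigma>')"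
      "case \<sigma>' of (f, i, p) \<Rightarrow> p = ys" .
  then show ?thesis unfolding ram_computes_within_def
    by (intro exI[of _ t] exI[of _ "at_pc (0 + csize c) \<sigma>'"]) (auto simp: ram_init_def at_pc_def)
qed

section \<open>The search program\<close>

definition rv :: "(nat \<Rightarrow> int) \<Rightarrow> nat \<Rightarrow> real ^ 3" where
  "rv f r = vector [of_int (f r), of_int (f (r + 1)), of_int (f (r + 2))]"

lemma rv_eq_iff:
  "rv f r = x \<longleftrightarrow> of_int (f r) = x $ 1 \<and> of_int (f (r + 1)) = x $ 2 \<and> of_int (f (r + 2)) = x $ 3"
  by (auto simp: rv_def vec_eq_iff forall_3)

lemma rv_cong: "f r = g r \<Longrightarrow> f (r + 1) = g (r + 1) \<Longrightarrow> f (r + 2) = g (r + 2) \<Longrightarrow> rv f r = rv g r"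
  by (simp add: rv_def)

text \<open>
  Register layout. Registers 0 to 15 are fixed during the search: 0, 1 and 3 hold the constants 0, 1
  and the number of points, 4 to 6 the base point \<open>z\<close>, 7 and 8 the address and countdown of the loop
  over \<open>z\<close>, and 9 to 11 a zero vector. Registers 16 to 31 are scratch: 16 to 18 hold the current
  vertex, 19 is positive if some vertex was not found, 20 to 22 are flag, countdown and address of the
  lookup, 23 to 25 and 28 to 30 a difference of points and its negative, and 27 the best value found.
  The block at \<open>32 + 16 k\<close> belongs to direction \<open>k\<close>, with offsets 0 and 1 for the countdown and
  address of the loop over \<open>p\<^sub>k\<close>, 2 for the countdown of the loop over \<open>n\<^sub>k\<close>, 3 for the count
  increment (0 if \<open>p\<^sub>k = z\<close>), 4 to 6 for \<open>p\<^sub>k - z\<close>, 8 to 10 for \<open>n\<^sub>k (p\<^sub>k - z)\<close> and 12 for the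
  number of segments of the directions \<open>k, \<dots>, 7\<close>. The points are stored from address 176 on.
\<close>

definition loaded :: "(real ^ 3) list \<Rightarrow> (nat \<Rightarrow> int) \<Rightarrow> bool" where
  "loaded pts f \<longleftrightarrow> f 0 = 0 \<and> f 1 = 1 \<and> f 3 = int (length pts) \<and>
     (\<forall>i<length pts. rv f (176 + 3 * i) = pts ! i)"

lemma loaded_cong:
  assumes "loaded pts f" "\<And>r. r < 16 \<or> 176 \<le> r \<Longrightarrow> f' r = f r"
  shows "loaded pts f'"
  using assms by (auto simp: loaded_def rv_def)

text \<open>
  There is no jump on zero: a difference vanishes iff neither it nor its negative is positive.
\<close>

definition test :: "nat \<Rightarrow> int \<Rightarrow> com" where
  "test d v = Unless 23 (Unless 28 (Unless 24 (Unless 29 (Unless 25 (Unless 30 (Block [SET d v]))))))"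

lemma run_test:
  "run (test d v) 7 (f, io) (\<lambda>(f', io'). io' = io \<and> f' =
     (if f 23 \<le> 0 \<and> f 28 \<le> 0 \<and> f 24 \<le> 0 \<and> f 29 \<le> 0 \<and> f 25 \<le> 0 \<and> f 30 \<le> 0
      then f(d := v) else f))"
proof -
  have "run (test d v) (Suc (Suc (Suc (Suc (Suc (Suc 1)))))) (f, io) (\<lambda>(f', io'). io' = io \<and> f' =
     (if f 23 \<le> 0 \<and> f 28 \<le> 0 \<and> f 24 \<le> 0 \<and> f 29 \<le> 0 \<and> f 25 \<le> 0 \<and> f 30 \<le> 0
      then f(d := v) else f))"
    unfolding test_def by (intro run_Unless run_Block) auto
  then show ?thesis by (simp add: eval_nat_numeral)
qed

text \<open>One routine serves three loops. With \<open>a = 16\<close> it compares a stored point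
  with the current vertex, with \<open>a = 4\<close> it computes the difference to z and detects a
  zero direction, and with \<open>a = 9\<close>, the zero vector, it fetches a new z. The address
  register \<open>p\<close> moves on by 3 to the next point.\<close>

definition compare :: "nat \<Rightarrow> nat \<Rightarrow> nat \<Rightarrow> int \<Rightarrow> com" where
  "compare p a d v = Seq (Block
     [LOAD 23 p, ADD p p 1, LOAD 24 p, ADD p p 1, LOAD 25 p, ADD p p 1,
      SUB 23 23 a, SUB 24 24 (a + 1), SUB 25 25 (a + 2), SUB 28 0 23, SUB 29 0 24, SUB 30 0 25])
     (test d v)"

lemma run_compare:
  assumes f: "loaded pts f" "i < length pts" "f p = int (176 + 3 * i)"
    and p: "p \<notin> {0, 1, 3, 23, 24, 25, 28, 29, 30, a, a + 1, a + 2}" "p < 176"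
    and a: "a < 20"
    and d: "d \<notin> {p, 23, 24, 25, 28, 29, 30}"
  shows "run (compare p a d v) 19 (f, io) (\<lambda>(f', io'). io' = io \<and>
    f' p = int (176 + 3 * Suc i) \<and> f' d = (if pts ! i = rv f a then v else f d) \<and>
    rv f' 23 = pts ! i - rv f a \<and> (\<forall>r. r \<notin> {p, d, 23, 24, 25, 28, 29, 30} \<longrightarrow> f' r = f r))"
proof -
  let ?x = "f (176 + 3 * i) - f a" and ?y = "f (176 + 3 * i + 1) - f (a + 1)"
    and ?z = "f (176 + 3 * i + 2) - f (a + 2)"
  define R where "R = (\<lambda>(g :: nat \<Rightarrow> int, io'). io' = io \<and> g p = int (176 + 3 * Suc i) \<and>
    g 23 = ?x \<and> g 24 = ?y \<and> g 25 = ?z \<and> g 28 = - ?x \<and> g 29 = - ?y \<and> g 30 = - ?z \<and>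
    (\<forall>r. r \<notin> {p, 23, 24, 25, 28, 29, 30} \<longrightarrow> g r = f r))"
  have f0: "f 0 = 0" "f 1 = 1" and pt: "rv f (176 + 3 * i) = pts ! i"
    using f by (auto simp: loaded_def)
  have f1: "f (Suc 0) = 1" using f0 by simp
  have nat: "nat (176 + 3 * int i) = 176 + 3 * i" "nat (177 + 3 * int i) = 177 + 3 * i"
     "nat (178 + 3 * int i) = 178 + 3 * i" by auto
  have fp: "f p = 176 + 3 * int i" using f(3) by simp
  have neq: "p \<noteq> 0" "p \<noteq> 1" "p \<noteq> Suc 0" "p \<noteq> 23" "p \<noteq> 24" "p \<noteq> 25" "p \<noteq> 28" "p \<noteq> 29" "p \<noteq> 30"
    "p \<noteq> a" "p \<noteq> Suc a" "p \<noteq> Suc (Suc a)"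
    "a \<noteq> 21" "a \<noteq> 22" "a \<noteq> 23" "a \<noteq> 24" "a \<noteq> 25" "a \<noteq> 26" "a \<noteq> 27" "a \<noteq> 28" "a \<noteq> 29" "a \<noteq> 30"
    "p \<noteq> 176 + 3 * i" "p \<noteq> 177 + 3 * i" "p \<noteq> 178 + 3 * i"
    using p a by auto
  have 1: "run (Block
     [LOAD 23 p, ADD p p 1, LOAD 24 p, ADD p p 1, LOAD 25 p, ADD p p 1,
      SUB 23 23 a, SUB 24 24 (a + 1), SUB 25 25 (a + 2), SUB 28 0 23, SUB 29 0 24, SUB 30 0 25])
     12 (f, io) R"
    by (rule run_Block) (simp_all add: R_def neq neq[symmetric] fp f0 f1 nat)
  have eq: "pts ! i = rv f a \<longleftrightarrow> ?x = 0 \<and> ?y = 0 \<and> ?z = 0"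
    unfolding pt[symmetric] rv_eq_iff by (simp add: rv_def add.assoc)
  have "run (compare p a d v) (12 + 7) (f, io) (\<lambda>(f', io'). io' = io \<and>
    f' p = int (176 + 3 * Suc i) \<and> f' d = (if pts ! i = rv f a then v else f d) \<and>
    rv f' 23 = pts ! i - rv f a \<and> (\<forall>r. r \<notin> {p, d, 23, 24, 25, 28, 29, 30} \<longrightarrow> f' r = f r))"
    unfolding compare_def
  proof (rule run_Seq[OF 1])
    fix \<sigma> assume "R \<sigma>"
    moreover from this obtain g where \<sigma>: "\<sigma> = (g, io)" by (cases \<sigma>) (auto simp: R_def)
    ultimately have g: "R (g, io)" by simp
    have c: "(g 23 \<le> 0 \<and> g 28 \<le> 0 \<and> g 24 \<le> 0 \<and> g 29 \<le> 0 \<and> g 25 \<le> 0 \<and> g 30 \<le> 0) \<longleftrightarrow> pts ! i = rv f a"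
      unfolding eq using g by (auto simp: R_def)
    have r: "rv g 23 = pts ! i - rv f a"
      unfolding pt[symmetric] using g by (auto simp: rv_def R_def vec_eq_iff forall_3 add.assoc)
    have r': "rv (g(d := v)) 23 = rv g 23" using d by (intro rv_cong) auto
    show "run (test d v) 7 \<sigma> (\<lambda>(f', io'). io' = io \<and>
        f' p = int (176 + 3 * Suc i) \<and> f' d = (if pts ! i = rv f a then v else f d) \<and>
        rv f' 23 = pts ! i - rv f a \<and> (\<forall>r. r \<notin> {p, d, 23, 24, 25, 28, 29, 30} \<longrightarrow> f' r = f r))"
      unfolding \<sigma>
      by (rule run_mono[OF run_test]) (unfold c, use g r r' d in \<open>auto simp: R_def split: if_splits\<close>)
  qed
  then show ?thesis by simp
qed

section \<open>Testing all vertices of a zonotope\<close>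

fun allin :: "(real ^ 3) set \<Rightarrow> nat \<Rightarrow> (nat \<Rightarrow> real ^ 3) \<Rightarrow> real ^ 3 \<Rightarrow> bool" where
  "allin A 0 w c = (c \<in> A)"
| "allin A (Suc k) w c = (allin A k w c \<and> allin A k w (c + w k))"

fun vert :: "nat \<Rightarrow> com" where
  "vert 0 = Seq (Block [SET 20 0, ADD 21 3 0, SET 22 176])
     (Seq (DoWhile (Seq (compare 22 16 20 1) (Block [SUB 21 21 1])) 21)
       (Unless 20 (Block [SET 19 1])))"
| "vert (Suc k) = Seq (vert k)
     (Seq (Block [ADD 16 16 (40 + 16 * k), ADD 17 17 (41 + 16 * k), ADD 18 18 (42 + 16 * k)])
       (Seq (vert k)
         (Block [SUB 16 16 (40 + 16 * k), SUB 17 17 (41 + 16 * k), SUB 18 18 (42 + 16 * k)])))"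

text \<open>The bracketing is the one in which \<open>run_Seq\<close> adds up the bounds.\<close>

fun vert_time :: "nat \<Rightarrow> nat \<Rightarrow> nat" where
  "vert_time n 0 = 3 + (n * Suc (19 + 1) + Suc 1)"
| "vert_time n (Suc k) = vert_time n k + (3 + (vert_time n k + 3))"

text \<open>The scan has no early exit, so its number of passes is fixed. Register 20 remembers a
  hit; only a scan without a hit raises register 19.\<close>

lemma run_search:
  assumes f: "loaded pts f" and ne: "pts \<noteq> []"
  shows "run (vert 0) (vert_time (length pts) 0) (f, io) (\<lambda>(f', io'). io' = io \<and>
    (\<forall>r. r \<notin> {19..25} \<union> {28..30} \<longrightarrow> f' r = f r) \<and>
    (f' 19 > 0 \<longleftrightarrow> f 19 > 0 \<or> rv f 16 \<notin> set pts))"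
proof -
  define I where "I = (\<lambda>i (g :: nat \<Rightarrow> int, io'). io' = io \<and>
    (\<forall>r. r \<notin> {20..25} \<union> {28..30} \<longrightarrow> g r = f r) \<and> g 22 = int (176 + 3 * i) \<and>
    g 21 = int (length pts) - int i \<and> (g 20 > 0 \<longleftrightarrow> rv f 16 \<in> set (take i pts)))"
  show ?thesis
    unfolding vert.simps vert_time.simps
  proof (rule run_Seq)
    show "run (Block [SET 20 0, ADD 21 3 0, SET 22 176]) 3 (f, io) (I 0)"
      by (rule run_Block) (use f in \<open>simp_all add: I_def loaded_def\<close>)
  next
    fix \<sigma> assume init: "I 0 \<sigma>"
    show "run (Seq (DoWhile (Seq (compare 22 16 20 1) (Block [SUB 21 21 1])) 21)
       (Unless 20 (Block [SET 19 1]))) (length pts * Suc (19 + 1) + Suc 1) \<sigma>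
       (\<lambda>(f', io'). io' = io \<and>
    (\<forall>r. r \<notin> {19..25} \<union> {28..30} \<longrightarrow> f' r = f r) \<and>
    (f' 19 > 0 \<longleftrightarrow> f 19 > 0 \<or> rv f 16 \<notin> set pts))"
    proof (rule run_Seq[where R = "I (length pts)"])
      show "run (DoWhile (Seq (compare 22 16 20 1) (Block [SUB 21 21 1])) 21)
          (length pts * Suc (19 + 1)) \<sigma> (I (length pts))"
      proof (rule run_DoWhile[where I = I])
        fix i \<sigma> assume i: "i < length pts" and inv: "I i \<sigma>"
        obtain g where \<sigma>: "\<sigma> = (g, io)" using inv by (cases \<sigma>) (auto simp: I_def)
        have inv': "g 22 = int (176 + 3 * i)" "g 21 = int (length pts) - int i"
            "g 20 > 0 \<longleftrightarrow> rv f 16 \<in> set (take i pts)"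
          and gf: "\<And>r. r \<notin> {20..25} \<union> {28..30} \<Longrightarrow> g r = f r"
          using inv unfolding I_def \<sigma> prod.case by blast+
        have g: "loaded pts g"
          by (rule loaded_cong[OF f]) (auto simp: gf)
        have cur: "rv g 16 = rv f 16"
          by (rule rv_cong) (simp_all add: gf)
        show "run (Seq (compare 22 16 20 1) (Block [SUB 21 21 1])) (19 + 1) \<sigma>
          (\<lambda>\<sigma>'. I (Suc i) \<sigma>' \<and> (fst \<sigma>' 21 > 0 \<longleftrightarrow> Suc i < length pts))"
          unfolding \<sigma>
        proof (rule run_Seq[OF run_compare[OF g i]])
          show "g 22 = int (176 + 3 * i)" by (fact inv')
        next
          fix \<sigma>' assume *: "case \<sigma>' of (f', io') \<Rightarrow> io' = io \<and>
            f' 22 = int (176 + 3 * Suc i) \<and> f' 20 = (if pts ! i = rv g 16 then 1 else g 20) \<and>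
            rv f' 23 = pts ! i - rv g 16 \<and> (\<forall>r. r \<notin> {22, 20, 23, 24, 25, 28, 29, 30} \<longrightarrow> f' r = g r)"
          then obtain g' where \<sigma>': "\<sigma>' = (g', io)" by (cases \<sigma>') auto
          have g': "g' 22 = int (176 + 3 * Suc i)" "g' 20 = (if pts ! i = rv f 16 then 1 else g 20)"
            "\<And>r. r \<notin> {22, 20, 23, 24, 25, 28, 29, 30} \<Longrightarrow> g' r = g r"
            using * unfolding \<sigma>' prod.case cur by blast+
          have "g 1 = 1" using g by (simp add: loaded_def)
          then show "run (Block [SUB 21 21 1]) 1 \<sigma>'
            (\<lambda>\<sigma>'. I (Suc i) \<sigma>' \<and> (fst \<sigma>' 21 > 0 \<longleftrightarrow> Suc i < length pts))"
            unfolding \<sigma>' using i inv' gf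
            by (intro run_Block) (auto simp: I_def g' take_Suc_conv_app_nth)
        qed auto
      qed (use init ne in auto)
    next
      fix \<sigma> assume "I (length pts) \<sigma>"
      then show "run (Unless 20 (Block [SET 19 1])) (Suc 1) \<sigma> (\<lambda>(f', io'). io' = io \<and>
        (\<forall>r. r \<notin> {19..25} \<union> {28..30} \<longrightarrow> f' r = f r) \<and>
        (f' 19 > 0 \<longleftrightarrow> f 19 > 0 \<or> rv f 16 \<notin> set pts))"
        by (intro run_Unless run_Block) (auto simp: I_def)
    qed
  qed
qed

text \<open>Register 19 is never lowered, so at the end it reports a miss among any of the vertices.
  Registers 16 to 18 belong to the preserved ones, which lets the two halves of the recursion use
  the same statement.\<close>

lemma run_vert:
  assumes "loaded pts f" and ne: "pts \<noteq> []" and "k \<le> 8"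
  shows "run (vert k) (vert_time (length pts) k) (f, io) (\<lambda>(f', io'). io' = io \<and>
    (\<forall>r. r \<notin> {19..25} \<union> {28..30} \<longrightarrow> f' r = f r) \<and>
    (f' 19 > 0 \<longleftrightarrow> f 19 > 0 \<or> \<not> allin (set pts) k (\<lambda>j. rv f (40 + 16 * j)) (rv f 16)))"
  using assms(1,3)
proof (induction k arbitrary: f)
  case 0
  then show ?case using run_search[OF _ ne, of f io] by simp
next
  case (Suc k)
  define R where "R = (\<lambda>k (f :: nat \<Rightarrow> int) (f' :: nat \<Rightarrow> int, io'). io' = io \<and>
    (\<forall>r. r \<notin> {19..25} \<union> {28..30} \<longrightarrow> f' r = f r) \<and>
    (f' 19 > 0 \<longleftrightarrow> f 19 > 0 \<or> \<not> allin (set pts) k (\<lambda>j. rv f (40 + 16 * j)) (rv f 16)))"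
  have IH: "run (vert k) (vert_time (length pts) k) (f, io) (R k f)" if "loaded pts f" for f
    using Suc.IH[OF that] Suc.prems by (simp add: R_def)
  define S where "S = (\<lambda>f1. f1(16 := f1 16 + f1 (40 + 16 * k),
      17 := f1 17 + f1 (41 + 16 * k), 18 := f1 18 + f1 (42 + 16 * k)) :: nat \<Rightarrow> int)"
  have "run (vert (Suc k)) (vert_time (length pts) (Suc k)) (f, io) (R (Suc k) f)"
    unfolding vert.simps vert_time.simps
  proof (rule run_Seq[OF IH[OF Suc.prems(1)]])
    fix \<sigma> assume R1: "R k f \<sigma>"
    then obtain f1 where \<sigma>: "\<sigma> = (f1, io)" by (cases \<sigma>) (auto simp: R_def)
    have f1: "f1 r = f r" if "r \<notin> {19..25} \<union> {28..30}" for r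
      using that R1 unfolding R_def \<sigma> prod.case by blast
    have fl1: "f1 19 > 0 \<longleftrightarrow> f 19 > 0 \<or> \<not> allin (set pts) k (\<lambda>j. rv f (40 + 16 * j)) (rv f 16)"
      using R1 unfolding R_def \<sigma> prod.case by blast
    have S: "S f1 r = f1 r" if "r \<notin> {16, 17, 18}" for r
      using that by (auto simp: S_def)
    have l: "loaded pts (S f1)"
      by (rule loaded_cong[OF Suc.prems(1)]) (auto simp: S f1)
    have w: "rv (S f1) (40 + 16 * j) = rv f (40 + 16 * j)" for j
      by (intro rv_cong) (auto simp: S f1)
    have c: "rv (S f1) 16 = rv f 16 + rv f (40 + 16 * k)"
      by (simp add: S_def f1 rv_def vec_eq_iff forall_3)
    show "run (Seq (Block [ADD 16 16 (40 + 16 * k), ADD 17 17 (41 + 16 * k), ADD 18 18 (42 + 16 * k)])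
       (Seq (vert k)
         (Block [SUB 16 16 (40 + 16 * k), SUB 17 17 (41 + 16 * k), SUB 18 18 (42 + 16 * k)])))
         (3 + (vert_time (length pts) k + 3)) \<sigma> (R (Suc k) f)"
    proof (rule run_Seq[where R = "\<lambda>\<sigma>. \<sigma> = (S f1, io)"], goal_cases)
      case 1
      show ?case unfolding \<sigma> by (rule run_Block) (auto simp: S_def)
    next
      case (2 \<sigma>')
      show ?case unfolding 2
      proof (rule run_Seq[OF IH[OF l]])
        fix \<sigma> assume R2: "R k (S f1) \<sigma>"
        then obtain f2 where \<sigma>2: "\<sigma> = (f2, io)" by (cases \<sigma>) (auto simp: R_def)
        have f2: "f2 r = S f1 r" if "r \<notin> {19..25} \<union> {28..30}" for r
          using that R2 unfolding R_def \<sigma>2 prod.case by blast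
        have fl2: "f2 19 > 0 \<longleftrightarrow> S f1 19 > 0 \<or>
            \<not> allin (set pts) k (\<lambda>j. rv f (40 + 16 * j)) (rv f 16 + rv f (40 + 16 * k))"
          using R2 unfolding R_def \<sigma>2 prod.case w c by blast
        have fl: "f2 19 > 0 \<longleftrightarrow> f 19 > 0 \<or> \<not> allin (set pts) (Suc k) (\<lambda>j. rv f (40 + 16 * j)) (rv f 16)"
          using fl1 fl2 by (simp add: S)
        show "run (Block [SUB 16 16 (40 + 16 * k), SUB 17 17 (41 + 16 * k), SUB 18 18 (42 + 16 * k)])
          3 \<sigma> (R (Suc k) f)"
          unfolding \<sigma>2 by (rule run_Block) (simp_all add: R_def f2 S_def f1 fl del: allin.simps)
      qed
    qed
  qed
  then show ?case by (simp add: R_def)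
qed

section \<open>The nested loops over directions and multiplicities\<close>

fun vals :: "(real ^ 3) list \<Rightarrow> nat \<Rightarrow> (nat \<Rightarrow> real ^ 3) \<Rightarrow> real ^ 3 \<Rightarrow> int \<Rightarrow> int set" where
  "vals pts 0 w z c = (if allin (set pts) 8 w z then {c} else {})"
| "vals pts (Suc k) w z c = (\<Union>b<length pts. \<Union>n<length pts.
     vals pts k (w(k := real n *\<^sub>R (pts ! b - z))) z (c + int n * (if pts ! b = z then 0 else 1)))"

lemma allin_cong: "(\<And>j. j < k \<Longrightarrow> w j = w' j) \<Longrightarrow> allin A k w c = allin A k w' c"
  by (induction k arbitrary: c) auto

text \<open>\<open>vals pts k\<close> overwrites the entries of \<open>w\<close> below
  \<open>k\<close> before they are inspected. The blocks of those directions may therefore contain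
  leftovers from earlier passes of the loops.\<close>

lemma vals_cong:
  assumes "\<And>j. k \<le> j \<Longrightarrow> j < 8 \<Longrightarrow> w j = w' j"
  shows "vals pts k w z c = vals pts k w' z c"
  using assms
proof (induction k arbitrary: w w' c)
  case 0
  then show ?case using allin_cong[of 8 w w'] by simp
next
  case (Suc k)
  then have "vals pts k (w(k := x)) z c = vals pts k (w'(k := x)) z c" for x c
    by (intro Suc.IH) (auto simp: le_Suc_eq Suc_le_eq)
  then show ?case by simp
qed

text \<open>The new best value \<open>b'\<close> is the maximum of the old one and of
  \<open>A\<close>; as a relation this also covers empty \<open>A\<close> and composes along
  unions.\<close>

definition upd :: "int \<Rightarrow> int set \<Rightarrow> int \<Rightarrow> bool" where
  "upd b A b' \<longleftrightarrow> b' \<in> insert b A \<and> (\<forall>a\<in>insert b A. a \<le> b')"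

lemma upd_empty [simp]: "upd b {} b' \<longleftrightarrow> b' = b"
  by (auto simp: upd_def)

lemma upd_trans: "upd b A b' \<Longrightarrow> upd b' A' b'' \<Longrightarrow> upd b (A \<union> A') b''"
  by (auto simp: upd_def intro: order_trans)

text \<open>Register 44 is offset 12 of block 0, hence the count over all eight directions. The
  added 1 makes the sign test stop the update when the best value is at least this count, equality
  included.\<close>

definition leaf :: com where
  "leaf = Seq (Block [ADD 16 4 0, ADD 17 5 0, ADD 18 6 0, SET 19 0]) (Seq (vert 8)
     (Unless 19 (Seq (Block [SUB 23 27 44, ADD 23 23 1]) (Unless 23 (Block [ADD 27 44 0])))))"

text \<open>Level \<open>Suc k\<close> chooses p_k and n_k and leaves the directions below
  \<open>k\<close> to the copy of \<open>lev k\<close> inside its loops. The count at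
  \<open>44 + 16 * k\<close> starts from \<open>60 + 16 * k\<close>, the same offset in the block of
  direction \<open>k + 1\<close>. The inner loop runs \<open>lev k\<close> before each addition, so
  n_k takes the values from 0 to N - 1.\<close>

fun lev :: "nat \<Rightarrow> com" where
  "lev 0 = leaf"
| "lev (Suc k) = Seq (Block [ADD (32 + 16 * k) 3 0, SET (33 + 16 * k) 176])
     (DoWhile
       (Seq (Block [SET (35 + 16 * k) 1])
       (Seq (compare (33 + 16 * k) 4 (35 + 16 * k) 0)
       (Seq (Block [ADD (36 + 16 * k) 23 0, ADD (37 + 16 * k) 24 0, ADD (38 + 16 * k) 25 0,
               SET (40 + 16 * k) 0, SET (41 + 16 * k) 0, SET (42 + 16 * k) 0,
               ADD (44 + 16 * k) (60 + 16 * k) 0, ADD (34 + 16 * k) 3 0])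
       (Seq (DoWhile (Seq (lev k)
               (Block [ADD (40 + 16 * k) (40 + 16 * k) (36 + 16 * k),
                  ADD (41 + 16 * k) (41 + 16 * k) (37 + 16 * k),
                  ADD (42 + 16 * k) (42 + 16 * k) (38 + 16 * k),
                  ADD (44 + 16 * k) (44 + 16 * k) (35 + 16 * k),
                  SUB (34 + 16 * k) (34 + 16 * k) 1]))
               (34 + 16 * k))
         (Block [SUB (32 + 16 * k) (32 + 16 * k) 1])))))
       (32 + 16 * k))"

fun lev_time :: "nat \<Rightarrow> nat \<Rightarrow> nat" where
  "lev_time n 0 = 4 + (vert_time n 8 + Suc (2 + Suc 1))"
| "lev_time n (Suc k) = 2 + n * Suc (1 + (19 + (8 + (n * Suc (lev_time n k + 5) + 1))))"

definition lev_post ::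
  "(real ^ 3) list \<Rightarrow> nat \<Rightarrow> (nat \<Rightarrow> int) \<Rightarrow> int list \<times> int list \<Rightarrow> store \<Rightarrow> bool" where
  "lev_post pts k f io = (\<lambda>(f', io'). io' = io \<and>
     (\<forall>r. r < 16 \<or> 32 + 16 * k \<le> r \<longrightarrow> f' r = f r) \<and>
     upd (f 27) (vals pts k (\<lambda>j. rv f (40 + 16 * j)) (rv f 4) (f (44 + 16 * k))) (f' 27))"

lemma run_leaf:
  assumes f: "loaded pts f" and ne: "pts \<noteq> []"
  shows "run leaf (lev_time (length pts) 0) (f, io) (lev_post pts 0 f io)"
  unfolding leaf_def lev_time.simps
proof (rule run_Seq[where R = "\<lambda>\<sigma>. \<sigma> = (f(16 := f 4, 17 := f 5, 18 := f 6, 19 := 0), io)"], goal_cases)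
  case 1
  have "f 0 = 0" using f by (simp add: loaded_def)
  then show ?case by (intro run_Block) simp_all
next
  case (2 \<sigma>)
  define g where "g = f(16 := f 4, 17 := f 5, 18 := f 6, 19 := 0)"
  have g: "loaded pts g"
    by (rule loaded_cong[OF f]) (auto simp: g_def)
  have g19: "g 19 = 0" by (simp add: g_def)
  have gf: "g r = f r" if "r \<notin> {16..19}" for r using that by (auto simp: g_def)
  have cur: "rv g 16 = rv f 4" by (simp add: g_def rv_def)
  have w: "rv g (40 + 16 * j) = rv f (40 + 16 * j)" for j
    by (rule rv_cong) (auto simp: gf)
  have 8: "(8::nat) \<le> 8" by simp
  show ?case unfolding 2 g_def[symmetric]
  proof (rule run_Seq[OF run_vert[OF g ne 8]])
    fix \<sigma> assume *: "case \<sigma> of (f', io') \<Rightarrow> io' = io \<and>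
     (\<forall>r. r \<notin> {19..25} \<union> {28..30} \<longrightarrow> f' r = g r) \<and>
     (f' 19 > 0 \<longleftrightarrow> g 19 > 0 \<or> \<not> allin (set pts) 8 (\<lambda>j. rv g (40 + 16 * j)) (rv g 16))"
    then obtain h where \<sigma>: "\<sigma> = (h, io)" by (cases \<sigma>) auto
    have h: "\<And>r. r \<notin> {19..25} \<union> {28..30} \<Longrightarrow> h r = g r"
      "h 19 > 0 \<longleftrightarrow> \<not> allin (set pts) 8 (\<lambda>j. rv f (40 + 16 * j)) (rv f 4)"
      using * g19 unfolding \<sigma> prod.case cur w by auto
    have hf: "h r = f r" if "r \<notin> {16..25} \<union> {28..30}" for r using that by (auto simp: h gf)
    have h01: "h 0 = 0" "h (Suc 0) = 1" using f by (simp_all add: hf loaded_def)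
    define V where "V = vals pts 0 (\<lambda>j. rv f (40 + 16 * j)) (rv f 4) (f 44)"
    have V: "V = (if h 19 > 0 then {} else {f 44})" using h(2) by (simp add: V_def)
    have P: "lev_post pts 0 f io = (\<lambda>(f', io'). io' = io \<and>
      (\<forall>r. r < 16 \<or> 32 \<le> r \<longrightarrow> f' r = f r) \<and> upd (f 27) V (f' 27))"
      by (simp add: lev_post_def V_def)
    define h' where "h' = h(23 := f 27 - f 44 + 1)"
    show "run (Unless 19 (Seq (Block [SUB 23 27 44, ADD 23 23 1]) (Unless 23 (Block [ADD 27 44 0]))))
      (Suc (2 + Suc 1)) \<sigma> (lev_post pts 0 f io)"
      unfolding \<sigma> P
    proof (rule run_Unless, goal_cases)
      case 1
      then show ?case by (auto simp: V hf)
    next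
      case 2
      show ?case
      proof (rule run_Seq[where R = "\<lambda>\<sigma>. \<sigma> = (h', io)"], goal_cases)
        case 1
        show ?case by (rule run_Block) (simp_all add: h01 hf h'_def)
      next
        case (2 \<sigma>')
        show ?case unfolding 2
          using \<open>fst (h, io) 19 \<le> 0\<close>
          by (intro run_Unless run_Block) (auto simp: V hf h'_def h01 upd_def)
      qed
    qed
  qed
qed

text \<open>Induction on the level, with one invariant for the loop over p_k and one for the loop
  over n_k. The bound on \<open>k\<close> keeps the blocks that are written below address 176, where
  the points are stored.\<close>

lemma run_lev:
  assumes "loaded pts f" and ne: "pts \<noteq> []" and "k \<le> 8"
  shows "run (lev k) (lev_time (length pts) k) (f, io) (lev_post pts k f io)"
  using assms(1,3)
proof (induction k arbitrary: f)
  case 0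
  then show ?case using run_leaf[OF _ ne] by simp
next
  case (Suc k)
  define N where "N = length pts"
  have N: "N > 0" using ne by (simp add: N_def)
  have k: "k < 8" using Suc.prems by simp
  have f013: "f 0 = 0" "f (Suc 0) = 1" "f 3 = int N"
    using Suc.prems(1) by (simp_all add: loaded_def N_def)
  define inc where "inc = (\<lambda>b. if pts ! b = rv f 4 then 0 else 1 :: int)"
  define W where "W = (\<lambda>j. rv f (40 + 16 * j))"
  \<comment> \<open>The counts reached with p_k the point number \<open>b\<close> and n_k =
    \<open>n\<close>.\<close>
  define V where "V = (\<lambda>b n. vals pts k (W(k := real n *\<^sub>R (pts ! b - rv f 4))) (rv f 4)
     (f (60 + 16 * k) + int n * inc b))"
  have post: "lev_post pts (Suc k) f io = (\<lambda>(f', io'). io' = io \<and>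
     (\<forall>r. r < 16 \<or> 48 + 16 * k \<le> r \<longrightarrow> f' r = f r) \<and>
     upd (f 27) (\<Union>b<N. \<Union>n<N. V b n) (f' 27))"
    by (simp add: lev_post_def V_def W_def N_def inc_def)
  define I where "I = (\<lambda>i (g :: nat \<Rightarrow> int, io'). io' = io \<and>
     (\<forall>r. r < 16 \<or> 48 + 16 * k \<le> r \<longrightarrow> g r = f r) \<and>
     g (32 + 16 * k) = int N - int i \<and> g (33 + 16 * k) = int (176 + 3 * i) \<and>
     upd (f 27) (\<Union>b<i. \<Union>n<N. V b n) (g 27))"
  \<comment> \<open>The address already belongs to point \<open>Suc i\<close>, since
    \<open>compare\<close> has moved it on before the inner loop starts.\<close>
  define J where "J = (\<lambda>i m (g :: nat \<Rightarrow> int, io'). io' = io \<and>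
     (\<forall>r. r < 16 \<or> 48 + 16 * k \<le> r \<longrightarrow> g r = f r) \<and>
     g (32 + 16 * k) = int N - int i \<and> g (33 + 16 * k) = int (176 + 3 * Suc i) \<and>
     g (34 + 16 * k) = int N - int m \<and> g (35 + 16 * k) = inc i \<and>
     rv g (36 + 16 * k) = pts ! i - rv f 4 \<and>
     rv g (40 + 16 * k) = real m *\<^sub>R (pts ! i - rv f 4) \<and>
     g (44 + 16 * k) = f (60 + 16 * k) + int m * inc i \<and>
     upd (f 27) ((\<Union>b<i. \<Union>n<N. V b n) \<union> (\<Union>n<m. V i n)) (g 27))"
  have inner: "run (Seq (lev k)
               (Block [ADD (40 + 16 * k) (40 + 16 * k) (36 + 16 * k),
                  ADD (41 + 16 * k) (41 + 16 * k) (37 + 16 * k),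
                  ADD (42 + 16 * k) (42 + 16 * k) (38 + 16 * k),
                  ADD (44 + 16 * k) (44 + 16 * k) (35 + 16 * k),
                  SUB (34 + 16 * k) (34 + 16 * k) 1])) (lev_time N k + 5) \<sigma>
          (\<lambda>\<sigma>'. J i (Suc m) \<sigma>' \<and> (fst \<sigma>' (34 + 16 * k) > 0 \<longleftrightarrow> Suc m < N))"
    if J: "J i m \<sigma>" and m: "m < N" for i m \<sigma>
  proof -
    obtain g where \<sigma>: "\<sigma> = (g, io)" using J by (cases \<sigma>) (auto simp: J_def)
    have gf: "g r = f r" if "r < 16 \<or> 48 + 16 * k \<le> r" for r
      using J that unfolding J_def \<sigma> prod.case by blast
    have gJ: "g (32 + 16 * k) = int N - int i" "g (33 + 16 * k) = int (176 + 3 * Suc i)"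
     "g (34 + 16 * k) = int N - int m" "g (35 + 16 * k) = inc i"
     "rv g (36 + 16 * k) = pts ! i - rv f 4"
     "rv g (40 + 16 * k) = real m *\<^sub>R (pts ! i - rv f 4)"
     "g (44 + 16 * k) = f (60 + 16 * k) + int m * inc i"
     "upd (f 27) ((\<Union>b<i. \<Union>n<N. V b n) \<union> (\<Union>n<m. V i n)) (g 27)"
      using J unfolding J_def \<sigma> prod.case by blast+
    have l: "loaded pts g"
      by (rule loaded_cong[OF Suc.prems(1)]) (use k in \<open>auto simp: gf\<close>)
    have z: "rv g 4 = rv f 4" by (rule rv_cong) (simp_all add: gf)
    have "vals pts k (\<lambda>j. rv g (40 + 16 * j)) (rv g 4) (g (44 + 16 * k)) = V i m"
      unfolding z gJ V_def
    proof (rule vals_cong)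
      fix j assume "k \<le> j"
      show "rv g (40 + 16 * j) = (W(k := real m *\<^sub>R (pts ! i - rv f 4))) j"
      proof (cases "j = k")
        case True
        then show ?thesis using gJ by simp
      next
        case False
        with \<open>k \<le> j\<close> have "k < j" by simp
        then have "rv g (40 + 16 * j) = rv f (40 + 16 * j)" by (intro rv_cong) (simp_all add: gf)
        then show ?thesis using False by (simp add: W_def)
      qed
    qed
    then have IH: "run (lev k) (lev_time N k) (g, io) (\<lambda>(f', io'). io' = io \<and>
       (\<forall>r. r < 16 \<or> 32 + 16 * k \<le> r \<longrightarrow> f' r = g r) \<and> upd (g 27) (V i m) (f' 27))"
      using Suc.IH[OF l] Suc.prems(2) by (simp add: lev_post_def N_def)
    show ?thesis unfolding \<sigma>
    proof (rule run_Seq[OF IH])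
      fix \<sigma>' assume *: "case \<sigma>' of (f', io') \<Rightarrow> io' = io \<and>
       (\<forall>r. r < 16 \<or> 32 + 16 * k \<le> r \<longrightarrow> f' r = g r) \<and> upd (g 27) (V i m) (f' 27)"
      then obtain h where \<sigma>': "\<sigma>' = (h, io)" by (cases \<sigma>') auto
      have hg: "h r = g r" if "r < 16 \<or> 32 + 16 * k \<le> r" for r
        using * that unfolding \<sigma>' prod.case by blast
      have "upd (g 27) (V i m) (h 27)" using * unfolding \<sigma>' prod.case by blast
      with gJ(8) have "upd (f 27) (((\<Union>b<i. \<Union>n<N. V b n) \<union> (\<Union>n<m. V i n)) \<union> V i m) (h 27)"
        by (rule upd_trans)
      then have u: "upd (f 27) ((\<Union>b<i. \<Union>n<N. V b n) \<union> (\<Union>n<Suc m. V i n)) (h 27)"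
        by (simp add: lessThan_Suc Un_ac)
      define h' where "h' = h(40 + 16 * k := g (40 + 16 * k) + g (36 + 16 * k),
         41 + 16 * k := g (41 + 16 * k) + g (37 + 16 * k),
         42 + 16 * k := g (42 + 16 * k) + g (38 + 16 * k),
         44 + 16 * k := g (44 + 16 * k) + g (35 + 16 * k),
         34 + 16 * k := g (34 + 16 * k) - 1)"
      have g1: "g (Suc 0) = 1" using f013 by (simp add: gf)
      have v: "rv h' (36 + 16 * k) = pts ! i - rv f 4"
        unfolding gJ(5)[symmetric] by (rule rv_cong) (simp_all add: h'_def hg)
      have w: "rv h' (40 + 16 * k) = real (Suc m) *\<^sub>R (pts ! i - rv f 4)"
      proof -
        have "rv h' (40 + 16 * k) = rv g (40 + 16 * k) + rv g (36 + 16 * k)"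
          by (simp add: rv_def h'_def hg vec_eq_iff forall_3)
        then show ?thesis unfolding gJ by (simp add: algebra_simps)
      qed
      have J': "J i (Suc m) (h', io) \<and> (h' (34 + 16 * k) > 0 \<longleftrightarrow> Suc m < N)"
        unfolding J_def prod.case v w
        using u m by (simp add: h'_def hg gf gJ distrib_right) arith
      show "run (Block [ADD (40 + 16 * k) (40 + 16 * k) (36 + 16 * k),
                  ADD (41 + 16 * k) (41 + 16 * k) (37 + 16 * k),
                  ADD (42 + 16 * k) (42 + 16 * k) (38 + 16 * k),
                  ADD (44 + 16 * k) (44 + 16 * k) (35 + 16 * k),
                  SUB (34 + 16 * k) (34 + 16 * k) 1]) 5 \<sigma>'
          (\<lambda>\<sigma>'. J i (Suc m) \<sigma>' \<and> (fst \<sigma>' (34 + 16 * k) > 0 \<longleftrightarrow> Suc m < N))"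
        unfolding \<sigma>' by (rule run_Block) (use J' in \<open>simp_all add: hg g1 h'_def\<close>)
    qed
  qed
  have outer: "run (Seq (Block [SET (35 + 16 * k) 1])
       (Seq (compare (33 + 16 * k) 4 (35 + 16 * k) 0)
       (Seq (Block [ADD (36 + 16 * k) 23 0, ADD (37 + 16 * k) 24 0, ADD (38 + 16 * k) 25 0,
               SET (40 + 16 * k) 0, SET (41 + 16 * k) 0, SET (42 + 16 * k) 0,
               ADD (44 + 16 * k) (60 + 16 * k) 0, ADD (34 + 16 * k) 3 0])
       (Seq (DoWhile (Seq (lev k)
               (Block [ADD (40 + 16 * k) (40 + 16 * k) (36 + 16 * k),
                  ADD (41 + 16 * k) (41 + 16 * k) (37 + 16 * k),
                  ADD (42 + 16 * k) (42 + 16 * k) (38 + 16 * k),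
                  ADD (44 + 16 * k) (44 + 16 * k) (35 + 16 * k),
                  SUB (34 + 16 * k) (34 + 16 * k) 1]))
               (34 + 16 * k))
         (Block [SUB (32 + 16 * k) (32 + 16 * k) 1])))))
      (1 + (19 + (8 + (N * Suc (lev_time N k + 5) + 1)))) \<sigma>
      (\<lambda>\<sigma>'. I (Suc i) \<sigma>' \<and> (fst \<sigma>' (32 + 16 * k) > 0 \<longleftrightarrow> Suc i < N))"
    if I: "I i \<sigma>" and i: "i < N" for i \<sigma>
  proof -
    obtain g where \<sigma>: "\<sigma> = (g, io)" using I by (cases \<sigma>) (auto simp: I_def)
    have gf: "g r = f r" if "r < 16 \<or> 48 + 16 * k \<le> r" for r
      using I that unfolding I_def \<sigma> prod.case by blast
    have gI: "g (32 + 16 * k) = int N - int i" "g (33 + 16 * k) = int (176 + 3 * i)"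
       "upd (f 27) (\<Union>b<i. \<Union>n<N. V b n) (g 27)"
      using I unfolding I_def \<sigma> prod.case by blast+
    define g1 where "g1 = g(35 + 16 * k := 1)"
    have l: "loaded pts g1"
      by (rule loaded_cong[OF Suc.prems(1)]) (use k in \<open>auto simp: gf g1_def\<close>)
    have z: "rv g1 4 = rv f 4" by (rule rv_cong) (simp_all add: gf g1_def)
    have i': "i < length pts" using i by (simp add: N_def)
    show ?thesis unfolding \<sigma>
    proof (rule run_Seq[where R = "\<lambda>\<sigma>. \<sigma> = (g1, io)"], goal_cases)
      case 1
      show ?case by (rule run_Block) (simp_all add: g1_def)
    next
      case (2 \<sigma>1)
      show ?case unfolding 2
      proof (rule run_Seq[OF run_compare[OF l i']])
        show "g1 (33 + 16 * k) = int (176 + 3 * i)" using gI by (simp add: g1_def)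
      next
        fix \<sigma>2 assume *: "case \<sigma>2 of (f', io') \<Rightarrow> io' = io \<and>
          f' (33 + 16 * k) = int (176 + 3 * Suc i) \<and>
          f' (35 + 16 * k) = (if pts ! i = rv g1 4 then 0 else g1 (35 + 16 * k)) \<and>
          rv f' 23 = pts ! i - rv g1 4 \<and>
          (\<forall>r. r \<notin> {33 + 16 * k, 35 + 16 * k, 23, 24, 25, 28, 29, 30} \<longrightarrow> f' r = g1 r)"
        then obtain g2 where \<sigma>2: "\<sigma>2 = (g2, io)" by (cases \<sigma>2) auto
        have g2: "g2 (33 + 16 * k) = int (176 + 3 * Suc i)" "g2 (35 + 16 * k) = inc i"
          "rv g2 23 = pts ! i - rv f 4"
          using * unfolding \<sigma>2 prod.case z inc_def by (simp_all add: g1_def)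
        have g2g: "g2 r = g r" if "r \<notin> {33 + 16 * k, 35 + 16 * k, 23, 24, 25, 28, 29, 30}" for r
          using * that unfolding \<sigma>2 prod.case g1_def by simp
        have g20: "g2 0 = 0" using f013 by (simp add: g2g gf)
        define g3 where "g3 = g2(36 + 16 * k := g2 23, 37 + 16 * k := g2 24, 38 + 16 * k := g2 25,
           40 + 16 * k := 0, 41 + 16 * k := 0, 42 + 16 * k := 0,
           44 + 16 * k := f (60 + 16 * k), 34 + 16 * k := f 3)"
        have v: "rv g3 (36 + 16 * k) = pts ! i - rv f 4"
          unfolding g2(3)[symmetric] by (simp add: rv_def g3_def)
        have w: "rv g3 (40 + 16 * k) = 0"
          by (simp add: rv_def g3_def vec_eq_iff forall_3)
        have J0: "J i 0 (g3, io)"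
          unfolding J_def prod.case v w
          using f013 gI(3) by (simp add: g3_def g2 g2g gf gI)
        show "run (Seq (Block [ADD (36 + 16 * k) 23 0, ADD (37 + 16 * k) 24 0, ADD (38 + 16 * k) 25 0,
               SET (40 + 16 * k) 0, SET (41 + 16 * k) 0, SET (42 + 16 * k) 0,
               ADD (44 + 16 * k) (60 + 16 * k) 0, ADD (34 + 16 * k) 3 0])
           (Seq (DoWhile (Seq (lev k)
               (Block [ADD (40 + 16 * k) (40 + 16 * k) (36 + 16 * k),
                  ADD (41 + 16 * k) (41 + 16 * k) (37 + 16 * k),
                  ADD (42 + 16 * k) (42 + 16 * k) (38 + 16 * k),
                  ADD (44 + 16 * k) (44 + 16 * k) (35 + 16 * k),
                  SUB (34 + 16 * k) (34 + 16 * k) 1]))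
               (34 + 16 * k))
           (Block [SUB (32 + 16 * k) (32 + 16 * k) 1])))
           (8 + (N * Suc (lev_time N k + 5) + 1)) \<sigma>2
           (\<lambda>\<sigma>'. I (Suc i) \<sigma>' \<and> (fst \<sigma>' (32 + 16 * k) > 0 \<longleftrightarrow> Suc i < N))"
        proof (rule run_Seq[where R = "J i 0"], goal_cases)
          case 1
          show ?case unfolding \<sigma>2
            by (rule run_Block) (use J0 in \<open>simp_all add: g3_def g20 g2g gf\<close>)
        next
          case (2 \<sigma>3)
          show ?case
          proof (rule run_Seq[OF run_DoWhile[where I = "J i" and Q = "J i N", OF 2 N]], goal_cases)
            case (1 m \<sigma>)
            then show ?case using inner by blast
          next
            case (3 \<sigma>4)
            then obtain g4 where \<sigma>4: "\<sigma>4 = (g4, io)" by (cases \<sigma>4) (auto simp: J_def)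
            have g4f: "g4 r = f r" if "r < 16 \<or> 48 + 16 * k \<le> r" for r
              using 3 that unfolding J_def \<sigma>4 prod.case by blast
            have g4: "g4 (32 + 16 * k) = int N - int i" "g4 (33 + 16 * k) = int (176 + 3 * Suc i)"
              "upd (f 27) ((\<Union>b<i. \<Union>n<N. V b n) \<union> (\<Union>n<N. V i n)) (g4 27)"
              using 3 unfolding J_def \<sigma>4 prod.case by blast+
            have u: "upd (f 27) (\<Union>b<Suc i. \<Union>n<N. V b n) (g4 27)"
              using g4(3) by (simp add: lessThan_Suc Un_ac)
            have g41: "g4 (Suc 0) = 1" using f013 by (simp add: g4f)
            have "1 < int N - int i \<longleftrightarrow> Suc i < N" by arith
            then show ?case unfolding \<sigma>4
              by (intro run_Block) (use u i in \<open>simp_all add: I_def g41 g4 g4f\<close>)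
          qed
        qed
      qed (use k in auto)
    qed
  qed
  show ?case
    unfolding lev.simps lev_time.simps N_def[symmetric] post
  proof (rule run_Seq[where R = "I 0"], goal_cases)
    case 1
    show ?case
      by (rule run_Block) (use f013 in \<open>simp_all add: I_def\<close>)
  next
    case (2 \<sigma>)
    show ?case
    proof (rule run_DoWhile[where I = I, OF 2 N], goal_cases)
      case (1 i \<sigma>)
      then show ?case using outer by blast
    next
      case (2 \<sigma>)
      then show ?case by (auto simp: I_def)
    qed
  qed
qed

section \<open>The complete program\<close>

definition minkowski_prog :: com where
  "minkowski_prog = Seq (Block [READ 3, SET 1 1, ADD 21 3 0, SET 22 176])
     (Seq (DoWhile (Block [READ 23, STORE 22 23, ADD 22 22 1, READ 23, STORE 22 23, ADD 22 22 1,
         READ 23, STORE 22 23, ADD 22 22 1, SUB 21 21 1]) 21)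
     (Seq (Block [ADD 8 3 0, SET 7 176])
     (Seq (DoWhile (Seq (compare 7 9 31 0) (Seq (Block [ADD 4 23 0, ADD 5 24 0, ADD 6 25 0])
         (Seq (lev 8) (Block [SUB 8 8 1])))) 8)
       (Block [PRINT 27]))))"

definition total_time :: "nat \<Rightarrow> nat" where
  "total_time n = 4 + (n * Suc 10 + (2 + (n * Suc (19 + (3 + (lev_time n 8 + 1))) + 1)))"

text \<open>The last conjunct records that reading leaves the initial zeros alone: the zero vector
  in 9 to 11, the best value in 27 and the starting count in 172 are never set explicitly.\<close>

lemma run_read:
  assumes ne: "pts \<noteq> []" and lat: "set pts \<subseteq> int_lattice"
    and g: "g 0 = 0" "g 1 = 1" "g 3 = int (length pts)" "g 21 = int (length pts)" "g 22 = 176"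
      "\<And>r. r \<notin> {1, 3, 21, 22, 23} \<Longrightarrow> r < 176 \<Longrightarrow> g r = 0"
  shows "run (DoWhile (Block [READ 23, STORE 22 23, ADD 22 22 1, READ 23, STORE 22 23, ADD 22 22 1,
         READ 23, STORE 22 23, ADD 22 22 1, SUB 21 21 1]) 21) (length pts * Suc 10)
     (g, concat (map (\<lambda>x. [\<lfloor>x $ 1\<rfloor>, \<lfloor>x $ 2\<rfloor>, \<lfloor>x $ 3\<rfloor>]) pts), [])
     (\<lambda>(f, io). io = ([], []) \<and> loaded pts f \<and>
        (\<forall>r. r \<notin> {1, 3, 21, 22, 23} \<longrightarrow> r < 176 \<longrightarrow> f r = 0))"
proof -
  define N where "N = length pts"
  define enc where "enc = (\<lambda>x :: real ^ 3. [\<lfloor>x $ 1\<rfloor>, \<lfloor>x $ 2\<rfloor>, \<lfloor>x $ 3\<rfloor>])"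
  define I where "I = (\<lambda>i (f :: nat \<Rightarrow> int, io).
     io = (concat (map enc (drop i pts)), [] :: int list) \<and> f 1 = 1 \<and> f 3 = int N \<and> f 21 = int N - int i \<and>
     f 22 = int (176 + 3 * i) \<and> (\<forall>j<i. rv f (176 + 3 * j) = pts ! j) \<and>
     (\<forall>r. r \<notin> {1, 3, 21, 22, 23} \<longrightarrow> r < 176 \<longrightarrow> f r = 0))"
  have N: "N > 0" using ne by (simp add: N_def)
  show ?thesis
    unfolding N_def[symmetric] enc_def[symmetric]
  proof (rule run_DoWhile[where I = I, OF _ N], goal_cases)
    case 1
    show ?case using g by (simp add: I_def N_def)
  next
    case (2 i \<sigma>)
    from 2(2) obtain f where \<sigma>: "\<sigma> = (f, concat (map enc (drop i pts)), [])"
      by (cases \<sigma>) (auto simp: I_def)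
    have f: "f 1 = 1" "f 3 = int N" "f 21 = int N - int i" "f 22 = int (176 + 3 * i)"
        "\<And>j. j < i \<Longrightarrow> rv f (176 + 3 * j) = pts ! j"
        "\<And>r. r \<notin> {1, 3, 21, 22, 23} \<Longrightarrow> r < 176 \<Longrightarrow> f r = 0"
      using 2(2) unfolding I_def \<sigma> prod.case by blast+
    define x where "x = pts ! i"
    have dr: "concat (map enc (drop i pts)) =
        \<lfloor>x $ 1\<rfloor> # \<lfloor>x $ 2\<rfloor> # \<lfloor>x $ 3\<rfloor> # concat (map enc (drop (Suc i) pts))"
      using 2(1) by (simp add: Cons_nth_drop_Suc[symmetric] enc_def x_def N_def)
    define h where "h = f(176 + 3 * i := \<lfloor>x $ 1\<rfloor>, 177 + 3 * i := \<lfloor>x $ 2\<rfloor>, 178 + 3 * i := \<lfloor>x $ 3\<rfloor>,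
        23 := \<lfloor>x $ 3\<rfloor>, 22 := int (176 + 3 * Suc i), 21 := int N - int (Suc i))"
    have "x \<in> int_lattice" using lat 2(1) by (auto simp: x_def N_def)
    then have "rv h (176 + 3 * i) = x"
      by (simp add: rv_def h_def vec_eq_iff forall_3 int_lattice_def)
    moreover have "rv h (176 + 3 * j) = pts ! j" if "j < i" for j
      unfolding f(5)[OF that, symmetric] by (rule rv_cong) (use that in \<open>simp_all add: h_def\<close>)
    ultimately have m: "\<forall>j<Suc i. rv h (176 + 3 * j) = pts ! j"
      by (auto simp: less_Suc_eq x_def)
    have nat: "nat (176 + 3 * int i) = 176 + 3 * i" "nat (177 + 3 * int i) = 177 + 3 * i"
      "nat (178 + 3 * int i) = 178 + 3 * i" by auto
    have I: "I (Suc i) (h, concat (map enc (drop (Suc i) pts)), [])"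
      unfolding I_def prod.case using m f by (simp add: h_def)
    have h21: "0 < h 21 \<longleftrightarrow> Suc i < N" unfolding h_def by simp arith
    have "run (Block [READ 23, STORE 22 23, ADD 22 22 1, READ 23, STORE 22 23, ADD 22 22 1,
         READ 23, STORE 22 23, ADD 22 22 1, SUB 21 21 1]) 10 \<sigma>
         (\<lambda>\<sigma>. \<sigma> = (h, concat (map enc (drop (Suc i) pts)), []))"
      unfolding \<sigma> dr using f
      by (intro run_Block) (simp_all add: nat h_def fun_upd_twist fun_eq_iff)
    then show ?case
      by (rule run_mono) (use I h21 in auto)
  next
    case (3 \<sigma>)
    then show ?case by (auto simp: I_def loaded_def N_def)
  qed
qed

lemma run_minkowski_prog:
  assumes ne: "pts \<noteq> []" and lat: "set pts \<subseteq> int_lattice"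
  shows "run minkowski_prog (total_time (length pts)) (\<lambda>_. 0, encode_points pts, [])
     (\<lambda>(f, i, p). \<exists>b. p = [b] \<and> upd 0 (\<Union>i<length pts. vals pts 8 (\<lambda>_. 0) (pts ! i) 0) b)"
proof -
  define N where "N = length pts"
  have N: "N > 0" using ne by (simp add: N_def)
  define V where "V = (\<lambda>i. vals pts 8 (\<lambda>_. 0) (pts ! i) 0)"
  \<comment> \<open>Register 172 is offset 12 of the block position after direction 7;
    \<open>lev 8\<close> takes its starting count 0 from there.\<close>
  define I where "I = (\<lambda>i (f :: nat \<Rightarrow> int, io). io = ([] :: int list, [] :: int list) \<and> loaded pts f \<and>
     f 8 = int N - int i \<and> f 7 = int (176 + 3 * i) \<and> f 9 = 0 \<and> f 10 = 0 \<and> f 11 = 0 \<and> f 172 = 0 \<and>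
     upd 0 (\<Union>i<i. V i) (f 27))"
  have body: "run (Seq (compare 7 9 31 0) (Seq (Block [ADD 4 23 0, ADD 5 24 0, ADD 6 25 0])
         (Seq (lev 8) (Block [SUB 8 8 1])))) (19 + (3 + (lev_time N 8 + 1))) \<sigma>
         (\<lambda>\<sigma>'. I (Suc i) \<sigma>' \<and> (fst \<sigma>' 8 > 0 \<longleftrightarrow> Suc i < N))"
    if i: "i < N" and I: "I i \<sigma>" for i \<sigma>
  proof -
    obtain f where \<sigma>: "\<sigma> = (f, [], [])" using I by (cases \<sigma>) (auto simp: I_def)
    have l: "loaded pts f" and f: "f 8 = int N - int i" "f 7 = int (176 + 3 * i)"
      "f 9 = 0" "f 10 = 0" "f 11 = 0" "f 172 = 0" and u: "upd 0 (\<Union>i<i. V i) (f 27)"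
      using I unfolding I_def \<sigma> prod.case by blast+
    have i': "i < length pts" using i by (simp add: N_def)
    have z: "rv f 9 = 0" using f by (simp add: rv_def vec_eq_iff forall_3)
    show ?thesis unfolding \<sigma>
    proof (rule run_Seq[OF run_compare[OF l i' f(2)]])
      fix \<sigma>1 :: store assume *: "case \<sigma>1 of (f', io') \<Rightarrow> io' = ([], []) \<and> f' 7 = int (176 + 3 * Suc i) \<and>
        f' 31 = (if pts ! i = rv f 9 then 0 else f 31) \<and> rv f' 23 = pts ! i - rv f 9 \<and>
        (\<forall>r. r \<notin> {7, 31, 23, 24, 25, 28, 29, 30} \<longrightarrow> f' r = f r)"
      then obtain g where \<sigma>1: "\<sigma>1 = (g, [], [])" by (cases \<sigma>1) auto
      have g: "g 7 = int (176 + 3 * Suc i)" "rv g 23 = pts ! i"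
         "\<And>r. r \<notin> {7, 31, 23, 24, 25, 28, 29, 30} \<Longrightarrow> g r = f r"
        using * unfolding \<sigma>1 prod.case z by simp_all
      define h where "h = g(4 := g 23, 5 := g 24, 6 := g 25)"
      have lh: "loaded pts h"
        using l by (auto simp: loaded_def h_def g rv_def)
      have zh: "rv h 4 = pts ! i" unfolding g(2)[symmetric] by (simp add: rv_def h_def)
      have g0: "g 0 = 0" using l by (simp add: g loaded_def)
      show "run (Seq (Block [ADD 4 23 0, ADD 5 24 0, ADD 6 25 0]) (Seq (lev 8) (Block [SUB 8 8 1])))
        (3 + (lev_time N 8 + 1)) \<sigma>1 (\<lambda>\<sigma>'. I (Suc i) \<sigma>' \<and> (fst \<sigma>' 8 > 0 \<longleftrightarrow> Suc i < N))"
      proof (rule run_Seq[where R = "\<lambda>\<sigma>. \<sigma> = (h, [], [])"], goal_cases)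
        case 1
        show ?case unfolding \<sigma>1 by (rule run_Block) (simp_all add: h_def g0)
      next
        case (2 \<sigma>2)
        have 8: "(8::nat) \<le> 8" by simp
        show ?case unfolding 2 N_def
        proof (rule run_Seq[OF run_lev[OF lh ne 8]])
          fix \<sigma>3 assume *: "lev_post pts 8 h ([], []) \<sigma>3"
          obtain k where \<sigma>3: "\<sigma>3 = (k, [], [])" using * by (cases \<sigma>3) (auto simp: lev_post_def)
          have kh: "k r = h r" if "r < 16 \<or> 160 \<le> r" for r
          proof -
            have "\<forall>r. r < 16 \<or> 32 + 16 * 8 \<le> r \<longrightarrow> k r = h r"
              using * unfolding lev_post_def \<sigma>3 prod.case by blast
            with that show ?thesis by (elim disjE) simp_all
          qed
          have "vals pts 8 (\<lambda>j. rv h (40 + 16 * j)) (rv h 4) (h (44 + 16 * 8)) = V i"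
          proof -
            have "h (44 + 16 * 8) = 0" using f by (simp add: h_def g)
            then show ?thesis unfolding V_def zh by (simp only:) (rule vals_cong, simp)
          qed
          then have "upd (h 27) (V i) (k 27)" using * unfolding lev_post_def \<sigma>3 prod.case by simp
          moreover have "h 27 = f 27" by (simp add: h_def g)
          ultimately have u': "upd 0 (\<Union>i<Suc i. V i) (k 27)"
            using upd_trans[OF u] by (simp add: lessThan_Suc Un_ac)
          have lk: "loaded pts k" by (rule loaded_cong[OF lh]) (auto simp: kh)
          have k1: "k (Suc 0) = 1" using lk by (simp add: loaded_def)
          have l8: "loaded pts (k(8 := y))" for y using lk by (auto simp: loaded_def rv_def)
          have "1 < int N - int i \<longleftrightarrow> Suc i < N" by arith
          then show "run (Block [SUB 8 8 1]) 1 \<sigma>3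
             (\<lambda>\<sigma>'. I (Suc i) \<sigma>' \<and> (fst \<sigma>' 8 > 0 \<longleftrightarrow> Suc i < length pts))"
            unfolding \<sigma>3 N_def[symmetric]
            by (intro run_Block) (use u' l8 in \<open>simp_all add: I_def kh h_def g f k1\<close>)
        qed
      qed
    qed auto
  qed
  define g :: "nat \<Rightarrow> int" where "g = (\<lambda>_. 0)(3 := int N, 1 := 1, 21 := int N, 22 := 176)"
  let ?in = "concat (map (\<lambda>x. [\<lfloor>x $ 1\<rfloor>, \<lfloor>x $ 2\<rfloor>, \<lfloor>x $ 3\<rfloor>]) pts)"
  show ?thesis
    unfolding minkowski_prog_def total_time_def N_def[symmetric] V_def[symmetric]
  proof (rule run_Seq[where R = "\<lambda>\<sigma>. \<sigma> = (g, ?in, [])"], goal_cases)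
    case 1
    show ?case by (rule run_Block) (simp_all add: encode_points_def g_def N_def fun_eq_iff)
  next
    case (2 \<sigma>)
    show ?case unfolding 2 N_def
    proof (rule run_Seq[OF run_read[OF ne lat]])
      fix \<sigma>' :: store assume *: "case \<sigma>' of (f, io) \<Rightarrow> io = ([], []) \<and> loaded pts f \<and>
        (\<forall>r. r \<notin> {1, 3, 21, 22, 23} \<longrightarrow> r < 176 \<longrightarrow> f r = 0)"
      then obtain f where \<sigma>': "\<sigma>' = (f, [], [])" by (cases \<sigma>') auto
      have l: "loaded pts f" and f: "\<And>r. r \<notin> {1, 3, 21, 22, 23} \<Longrightarrow> r < 176 \<Longrightarrow> f r = 0"
        using * unfolding \<sigma>' prod.case by blast+
      have f3: "f 3 = int N" using l by (simp add: loaded_def N_def)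
      have I0: "I 0 (f(8 := int N, 7 := 176), [], [])"
        using l by (simp add: I_def f loaded_def rv_def)
      show "run (Seq (Block [ADD 8 3 0, SET 7 176])
     (Seq (DoWhile (Seq (compare 7 9 31 0) (Seq (Block [ADD 4 23 0, ADD 5 24 0, ADD 6 25 0])
         (Seq (lev 8) (Block [SUB 8 8 1])))) 8)
       (Block [PRINT 27]))) (2 + (length pts * Suc (19 + (3 + (lev_time (length pts) 8 + 1))) + 1)) \<sigma>'
       (\<lambda>(f, i, p). \<exists>b. p = [b] \<and> upd 0 (\<Union>i<length pts. V i) b)"
        unfolding N_def[symmetric]
      proof (rule run_Seq[where R = "I 0"], goal_cases)
        case 1
        show ?case unfolding \<sigma>' by (rule run_Block) (use I0 in \<open>simp_all add: f f3\<close>)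
      next
        case (2 \<sigma>)
        show ?case
        proof (rule run_Seq[OF run_DoWhile[where I = I and Q = "I N", OF 2 N]], goal_cases)
          case (1 i \<sigma>)
          then show ?case by (rule body)
        next
          case (3 \<sigma>)
          then show ?case
            by (intro run_Block) (auto simp: I_def)
        qed
      qed
    qed (simp_all add: g_def N_def)
  qed
qed

section \<open>The running time is polynomial\<close>

definition poly_bounded :: "(nat \<Rightarrow> nat) \<Rightarrow> bool" where
  "poly_bounded f \<longleftrightarrow> (\<exists>q. \<forall>n. f n = poly q n)"

lemma poly_bounded_const: "poly_bounded (\<lambda>n. c)"
  unfolding poly_bounded_def by (rule exI[of _ "[:c:]"]) simp

lemma poly_bounded_id: "poly_bounded (\<lambda>n. n)"
  unfolding poly_bounded_def by (rule exI[of _ "[:0, 1:]"]) simp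

lemma poly_bounded_add: "poly_bounded f \<Longrightarrow> poly_bounded g \<Longrightarrow> poly_bounded (\<lambda>n. f n + g n)"
  unfolding poly_bounded_def by (metis poly_add)

lemma poly_bounded_mult: "poly_bounded f \<Longrightarrow> poly_bounded g \<Longrightarrow> poly_bounded (\<lambda>n. f n * g n)"
  unfolding poly_bounded_def by (metis poly_mult)

lemma poly_bounded_Suc: "poly_bounded f \<Longrightarrow> poly_bounded (\<lambda>n. Suc (f n))"
  using poly_bounded_add[OF poly_bounded_const[of 1]] by simp

lemmas poly_bounded_intros =
  poly_bounded_const poly_bounded_id poly_bounded_add poly_bounded_mult poly_bounded_Suc

text \<open>The depth \<open>k\<close> is fixed: growth in \<open>k\<close> is exponential, but it
  only enters the coefficients. The time functions use only addition, multiplication and successor,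
  so they are themselves polynomials in \<open>n\<close>.\<close>

lemma poly_bounded_vert_time: "poly_bounded (\<lambda>n. vert_time n k)"
  by (induction k) (simp_all only: vert_time.simps, (intro poly_bounded_intros; assumption)+)

lemma poly_bounded_lev_time: "poly_bounded (\<lambda>n. lev_time n k)"
  by (induction k)
    (simp_all only: lev_time.simps, (intro poly_bounded_intros poly_bounded_vert_time; assumption)+)

lemma poly_bounded_total_time: "poly_bounded total_time"
  unfolding total_time_def by (intro poly_bounded_intros poly_bounded_lev_time)

section \<open>Few directions suffice\<close>

text \<open>Containment in \<open>P\<close> of z plus the Minkowski sum of the segments [0, v_i],
  written with coefficients: merging, grouping and splitting of segments become substitutions for
  \<open>t\<close>.\<close>

definition zonotope_in :: "(real ^ 'n) set \<Rightarrow> 'i set \<Rightarrow> real ^ 'n \<Rightarrow> ('i \<Rightarrow> real ^ 'n) \<Rightarrow> bool" where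
  "zonotope_in P I z v \<longleftrightarrow>
     (\<forall>t. (\<forall>i\<in>I. 0 \<le> t i \<and> t i \<le> 1) \<longrightarrow> z + (\<Sum>i\<in>I. t i *\<^sub>R v i) \<in> P)"

lemma int_lattice_0 [simp]: "0 \<in> int_lattice"
  and int_lattice_add: "x \<in> int_lattice \<Longrightarrow> y \<in> int_lattice \<Longrightarrow> x + y \<in> int_lattice"
  and int_lattice_diff: "x \<in> int_lattice \<Longrightarrow> y \<in> int_lattice \<Longrightarrow> x - y \<in> int_lattice"
  and int_lattice_scale: "x \<in> int_lattice \<Longrightarrow> real n *\<^sub>R x \<in> int_lattice"
  by (auto simp: int_lattice_def)

lemma int_lattice_sum: "(\<And>i. i \<in> I \<Longrightarrow> f i \<in> int_lattice) \<Longrightarrow> sum f I \<in> int_lattice"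
  by (auto simp: int_lattice_def intro!: Ints_sum)

lemma norm_square_Ints:
  fixes v :: "real ^ 'n"
  assumes "v \<in> int_lattice" shows "v \<bullet> v \<in> \<int>"
  using assms by (auto simp: inner_vec_def int_lattice_def intro!: Ints_sum Ints_mult)

text \<open>Squared lengths of lattice vectors are integers, so a strict decrease of them is a
  strict decrease of a natural number, and minimal choices exist.\<close>

lemma nat_floor_less:
  assumes "x \<in> \<int>" "y \<in> \<int>" "0 \<le> x" "x < (y :: real)"
  shows "nat \<lfloor>x\<rfloor> < nat \<lfloor>y\<rfloor>"
  using assms by (auto elim!: Ints_cases)

text \<open>Induction on the number of directions: a point with last coefficient \<open>t k\<close>
  is a convex combination of points of the two smaller zonotopes based at \<open>z\<close> and
  \<open>z + w k\<close>.\<close>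

lemma allin_imp_zonotope_in:
  assumes "convex P" "allin A k w z" "A \<subseteq> P"
  shows "zonotope_in P {..<k} z w"
  unfolding zonotope_in_def
proof (intro allI impI)
  fix t :: "nat \<Rightarrow> real" assume t: "\<forall>i\<in>{..<k}. 0 \<le> t i \<and> t i \<le> 1"
  show "z + (\<Sum>i<k. t i *\<^sub>R w i) \<in> P"
    using assms(2) t
  proof (induction k arbitrary: z)
    case 0
    then show ?case using assms(3) by auto
  next
    case (Suc k)
    have t: "0 \<le> t k" "t k \<le> 1" using Suc.prems(2) by auto
    have 1: "z + (\<Sum>i<k. t i *\<^sub>R w i) \<in> P" "(z + w k) + (\<Sum>i<k. t i *\<^sub>R w i) \<in> P"
      using Suc by auto
    have "(1 - t k) *\<^sub>R (z + (\<Sum>i<k. t i *\<^sub>R w i)) + t k *\<^sub>R ((z + w k) + (\<Sum>i<k. t i *\<^sub>R w i)) \<in> P"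
      using convexD[OF assms(1) 1, of "1 - t k" "t k"] t by simp
    then show ?case by (simp add: algebra_simps)
  qed
qed

text \<open>The vertices are lattice points, so testing them against the lattice points of
  \<open>P\<close> loses nothing.\<close>

lemma zonotope_in_imp_allin:
  assumes "zonotope_in P {..<k} z w" "z \<in> int_lattice" "\<And>i. i < k \<Longrightarrow> w i \<in> int_lattice"
  shows "allin (P \<inter> int_lattice) k w z"
  using assms
proof (induction k arbitrary: z)
  case 0
  then show ?case by (auto simp: zonotope_in_def)
next
  case (Suc k)
  \<comment> \<open>Overwriting the coefficient at \<open>k\<close> by \<open>s\<close>; the values
    0 and 1 give the two smaller zonotopes.\<close>
  have ext: "z + (\<Sum>i<k. t i *\<^sub>R w i) + s *\<^sub>R w k \<in> P"
    if "\<forall>i<k. 0 \<le> t i \<and> t i \<le> 1" "0 \<le> s" "s \<le> 1" for t :: "nat \<Rightarrow> real" and s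
  proof -
    have "z + (\<Sum>i<Suc k. (t(k := s)) i *\<^sub>R w i) \<in> P"
      using that by (intro Suc.prems(1)[unfolded zonotope_in_def, rule_format]) (auto simp: less_Suc_eq)
    then show ?thesis by (simp add: add.assoc)
  qed
  have "zonotope_in P {..<k} z w"
    using ext[of _ 0] by (auto simp: zonotope_in_def)
  moreover have "zonotope_in P {..<k} (z + w k) w"
    using ext[of _ 1] by (auto simp: zonotope_in_def algebra_simps)
  ultimately show ?case
    using Suc.IH[of z] Suc.IH[of "z + w k"] Suc.prems(2,3) by (simp add: int_lattice_add)
qed

section \<open>Merging directions congruent modulo 2\<close>

definition lexpos :: "real ^ 3 \<Rightarrow> bool" where
  "lexpos v \<longleftrightarrow> v $ 1 > 0 \<or> v $ 1 = 0 \<and> (v $ 2 > 0 \<or> v $ 2 = 0 \<and> v $ 3 > 0)"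

text \<open>The purpose of the orientation: \<open>v\<close> and \<open>- v\<close> are congruent
  modulo 2 but have mean 0, which is no direction. Lexicographically positive vectors are closed
  under means and non-zero.\<close>

lemma lexpos_mean: "lexpos v \<Longrightarrow> lexpos w \<Longrightarrow> lexpos ((1 / 2) *\<^sub>R (v + w))"
  by (auto simp: lexpos_def)

lemma lexpos_nonzero: "lexpos v \<Longrightarrow> v \<noteq> 0"
  by (auto simp: lexpos_def)

lemma lexpos_cases: "v \<noteq> 0 \<Longrightarrow> lexpos v \<or> lexpos (- v)"
  by (auto simp: lexpos_def vec_eq_iff forall_3)

definition parity :: "real ^ 3 \<Rightarrow> 3 set" where
  "parity v = {c. odd \<lfloor>v $ c\<rfloor>}"

lemma parity_mean:
  assumes "parity v = parity w" "v \<in> int_lattice" "w \<in> int_lattice"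
  shows "(1 / 2) *\<^sub>R (v + w) \<in> int_lattice"
  unfolding int_lattice_def
proof (intro CollectI allI)
  fix i
  obtain a b where ab: "v $ i = of_int a" "w $ i = of_int b"
    using assms(2,3) by (auto simp: int_lattice_def elim!: Ints_cases) (metis Ints_cases)
  have "odd a = odd b" using assms(1) by (auto simp: parity_def set_eq_iff dest!: spec[of _ i] simp: ab)
  then obtain c where "a + b = 2 * c" by (metis odd_add dvdE)
  then have "(v $ i + w $ i) / 2 = of_int c" unfolding ab of_int_add[symmetric] by simp
  then show "((1 / 2) *\<^sub>R (v + w)) $ i \<in> \<int>" by simp
qed

text \<open>The vectors range over all oriented lattice vectors, primitive or not, because the
  exchange leaves the primitive ones: (1,0,0) and (3,4,0) have mean (2,2,0).\<close>

definition config :: "(real ^ 3) set \<Rightarrow> nat \<Rightarrow> real ^ 3 \<Rightarrow> (nat \<Rightarrow> real ^ 3) \<Rightarrow> bool" where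
  "config P L z v \<longleftrightarrow> z \<in> int_lattice \<and> (\<forall>i<L. v i \<in> int_lattice \<and> lexpos (v i)) \<and>
     zonotope_in P {..<L} z v"

text \<open>
  Segments \<open>[0, v]\<close> and \<open>[0, w]\<close> with \<open>v \<noteq> w\<close> congruent modulo 2 can be replaced by two copies of
  \<open>[0, (v + w) / 2]\<close>, the diagonal of the parallelogram that they span. By the parallelogram law
  this decreases the sum of the squared lengths.
\<close>
lemma config_few_directions:
  assumes "config P L z0 v0"
  obtains z v where "config P L z v"
    "\<And>i j. i < L \<Longrightarrow> j < L \<Longrightarrow> parity (v i) = parity (v j) \<Longrightarrow> v i = v j"
proof -
  define m where "m = (\<lambda>v :: nat \<Rightarrow> real ^ 3. nat \<lfloor>\<Sum>i<L. v i \<bullet> v i\<rfloor>)"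
  have "\<exists>v. (\<exists>z. config P L z v) \<and> (\<forall>v'. (\<exists>z. config P L z v') \<longrightarrow> m v \<le> m v')"
    by (rule ex_has_least_nat) (use assms in blast)
  then obtain z v where c: "config P L z v" and min: "\<And>z' v'. config P L z' v' \<Longrightarrow> m v \<le> m v'"
    by blast
  show thesis
  proof (rule that[OF c], rule ccontr)
    fix i j assume ij: "i < L" "j < L" "parity (v i) = parity (v j)" "v i \<noteq> v j"
    then have "i \<noteq> j" by auto
    define u where "u = (1 / 2) *\<^sub>R (v i + v j)"
    define v' where "v' = v(i := u, j := u)"
    have v: "\<And>i. i < L \<Longrightarrow> v i \<in> int_lattice" "\<And>i. i < L \<Longrightarrow> lexpos (v i)"
      and zon: "zonotope_in P {..<L} z v"
      using c by (auto simp: config_def)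
    have u: "u \<in> int_lattice" "lexpos u"
      using parity_mean[OF ij(3)] lexpos_mean v ij by (auto simp: u_def)
    have split: "(\<Sum>l<L. f l) = f i + f j + (\<Sum>l\<in>{..<L} - {i, j}. f l)" for f :: "nat \<Rightarrow> 'b :: comm_monoid_add"
      using ij \<open>i \<noteq> j\<close> by (subst sum.subset_diff[of "{i, j}"]) (auto simp: ac_simps)
    have "zonotope_in P {..<L} z v'"
      unfolding zonotope_in_def
    proof (intro allI impI)
      fix t :: "nat \<Rightarrow> real" assume t: "\<forall>i\<in>{..<L}. 0 \<le> t i \<and> t i \<le> 1"
      \<comment> \<open>Both copies of \<open>u\<close> together contribute
        \<open>(t i + t j) *\<^sub>R u\<close>, which is
        \<open>s *\<^sub>R v i + s *\<^sub>R v j\<close>; every point of the new zonotope thus lies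
        in the old one.\<close>
      define s where "s = (t i + t j) / 2"
      define t' where "t' = t(i := s, j := s)"
      have "0 \<le> t i" "t i \<le> 1" "0 \<le> t j" "t j \<le> 1" using t ij by auto
      then have s: "0 \<le> s" "s \<le> 1" by (simp_all add: s_def)
      have rest: "(\<Sum>l\<in>{..<L} - {i, j}. t l *\<^sub>R v' l) = (\<Sum>l\<in>{..<L} - {i, j}. t' l *\<^sub>R v l)"
        by (rule sum.cong) (auto simp: v'_def t'_def)
      have "t i *\<^sub>R u + t j *\<^sub>R u = s *\<^sub>R v i + s *\<^sub>R v j"
        by (simp add: u_def s_def algebra_simps add_divide_distrib)
      then have "(\<Sum>l<L. t l *\<^sub>R v' l) = (\<Sum>l<L. t' l *\<^sub>R v l)"
        unfolding split rest using \<open>i \<noteq> j\<close> by (simp add: v'_def t'_def)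
      moreover have "z + (\<Sum>l<L. t' l *\<^sub>R v l) \<in> P"
        using zon t s unfolding zonotope_in_def by (auto simp: t'_def)
      ultimately show "z + (\<Sum>l<L. t l *\<^sub>R v' l) \<in> P" by simp
    qed
    moreover have v': "v' l \<in> int_lattice" "lexpos (v' l)" if "l < L" for l
      using v u that by (auto simp: v'_def)
    ultimately have "config P L z v'" using c by (auto simp: config_def)
    then have "m v \<le> m v'" by (rule min)
    moreover have "m v' < m v"
      unfolding m_def
    proof (rule nat_floor_less)
      show "(\<Sum>i<L. v i \<bullet> v i) \<in> \<int>" "(\<Sum>i<L. v' i \<bullet> v' i) \<in> \<int>"
        using v v' by (auto intro!: Ints_sum norm_square_Ints)
      show "0 \<le> (\<Sum>i<L. v' i \<bullet> v' i)" by (simp add: sum_nonneg)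
      have rest: "(\<Sum>l\<in>{..<L} - {i, j}. v' l \<bullet> v' l) = (\<Sum>l\<in>{..<L} - {i, j}. v l \<bullet> v l)"
        by (rule sum.cong) (auto simp: v'_def)
      have "0 < (v i - v j) \<bullet> (v i - v j)" using ij(4) by simp
      then have "u \<bullet> u + u \<bullet> u < v i \<bullet> v i + v j \<bullet> v j"
        by (simp add: u_def inner_add inner_diff inner_commute algebra_simps)
      then show "(\<Sum>i<L. v' i \<bullet> v' i) < (\<Sum>i<L. v i \<bullet> v i)"
        unfolding split rest using \<open>i \<noteq> j\<close> by (simp add: v'_def)
    qed
    ultimately show False by simp
  qed
qed

text \<open>Grouping by parity class: the vectors in one class coincide, and n_j copies of the
  segment [0, u_j] add up to [0, n_j u_j].\<close>

lemma config_8_directions: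
  assumes "config P L z0 v0"
  obtains z and n :: "nat \<Rightarrow> nat" and u where "z \<in> int_lattice" "(\<Sum>j<8. n j) = L"
    "\<And>j. j < 8 \<Longrightarrow> u j \<in> int_lattice" "\<And>j. j < 8 \<Longrightarrow> n j > 0 \<Longrightarrow> u j \<noteq> 0"
    "zonotope_in P {..<8} z (\<lambda>j. real (n j) *\<^sub>R u j)"
proof -
  obtain z v where c: "config P L z v"
    and eq: "\<And>i j. i < L \<Longrightarrow> j < L \<Longrightarrow> parity (v i) = parity (v j) \<Longrightarrow> v i = v j"
    using config_few_directions[OF assms] by blast
  \<comment> \<open>A residue class modulo 2 is the set of its odd coordinates; \<open>e\<close>
    numbers these sets.\<close>
  have "card (UNIV :: 3 set set) = 8"
    by (simp add: card_UNIV_set)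
  then obtain e :: "3 set \<Rightarrow> nat" where e: "bij_betw e UNIV {..<8}"
    using ex_bij_betw_finite_nat[of "UNIV :: 3 set set"] by (auto simp: atLeast0LessThan)
  define cl where "cl = (\<lambda>i. e (parity (v i)))"
  define G where "G = (\<lambda>j. {i\<in>{..<L}. cl i = j})"
  define n where "n = (\<lambda>j. card (G j))"
  \<comment> \<open>An empty class gets the zero vector, together with
    \<open>n j = 0\<close>.\<close>
  define u where "u = (\<lambda>j. if G j = {} then 0 else v (SOME i. i \<in> G j))"
  have cl: "cl ` {..<L} \<subseteq> {..<8}" using e by (auto simp: cl_def bij_betw_def)
  have u: "u (cl i) = v i" if "i < L" for i
  proof -
    have "i \<in> G (cl i)" using that by (simp add: G_def)
    moreover from this have "(SOME k. k \<in> G (cl i)) \<in> G (cl i)" by (rule someI)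
    ultimately show ?thesis
      using eq[of "SOME k. k \<in> G (cl i)" i] e that
      by (auto simp: u_def G_def cl_def bij_betw_def inj_eq)
  qed
  have v: "\<And>i. i < L \<Longrightarrow> v i \<in> int_lattice" "\<And>i. i < L \<Longrightarrow> lexpos (v i)"
    and zon: "zonotope_in P {..<L} z v" and z: "z \<in> int_lattice"
    using c by (auto simp: config_def)
  show thesis
  proof (rule that[of z n u])
    show "z \<in> int_lattice" by (fact z)
    have "(\<Sum>j<8. \<Sum>i\<in>G j. 1) = (\<Sum>i<L. 1 :: nat)"
      unfolding G_def by (rule sum.group) (use cl in auto)
    then show "(\<Sum>j<8. n j) = L" by (simp add: n_def)
    have ux: "u j = 0 \<and> n j = 0 \<or> (\<exists>i<L. u j = v i)" for j
    proof (cases "G j = {}")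
      case False
      then obtain i where "i \<in> G j" by blast
      then show ?thesis using u[of i] by (auto simp: G_def)
    qed (simp add: u_def n_def)
    show "u j \<in> int_lattice" for j using ux[of j] v by auto
    show "n j > 0 \<Longrightarrow> u j \<noteq> 0" for j using ux[of j] v lexpos_nonzero by fastforce
    show "zonotope_in P {..<8} z (\<lambda>j. real (n j) *\<^sub>R u j)"
      unfolding zonotope_in_def
    proof (intro allI impI)
      fix t :: "nat \<Rightarrow> real" assume t: "\<forall>i\<in>{..<8}. 0 \<le> t i \<and> t i \<le> 1"
      \<comment> \<open>The original zonotope is used only with coefficients that are constant on
        each class.\<close>
      have "(\<Sum>i<L. t (cl i) *\<^sub>R v i) = (\<Sum>j<8. \<Sum>i\<in>G j. t (cl i) *\<^sub>R v i)"
        unfolding G_def by (rule sum.group[symmetric]) (use cl in auto)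
      also have "\<dots> = (\<Sum>j<8. \<Sum>i\<in>G j. t j *\<^sub>R u j)"
        by (intro sum.cong refl) (auto simp: G_def u)
      also have "\<dots> = (\<Sum>j<8. t j *\<^sub>R (real (n j) *\<^sub>R u j))"
        by (intro sum.cong refl) (simp add: n_def sum_constant_scaleR mult.commute del: sum_constant)
      finally show "z + (\<Sum>j<8. t j *\<^sub>R (real (n j) *\<^sub>R u j)) \<in> P"
        using zon t cl unfolding zonotope_in_def by (auto simp: image_subset_iff dest!: spec[of _ "\<lambda>i. t (cl i)"])
    qed
  qed
qed

text \<open>Among the lattice points of the half-open segment from 0 to \<open>v\<close>, with 0
  removed, take a shortest one: a further lattice point between it and 0 would be shorter. This
  recovers primitive segments from arbitrary directions.\<close>

lemma primitive_in_segment: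
  fixes v :: "real ^ 'n"
  assumes "v \<in> int_lattice" "v \<noteq> 0"
  obtains r where "0 < r" "r \<le> 1" "r *\<^sub>R v \<in> int_lattice"
    "closed_segment 0 (r *\<^sub>R v) \<inter> int_lattice = {0, r *\<^sub>R v}"
proof -
  define S where "S = {r. 0 < r \<and> r \<le> 1 \<and> r *\<^sub>R v \<in> int_lattice}"
  define m where "m = (\<lambda>r. nat \<lfloor>(r *\<^sub>R v) \<bullet> (r *\<^sub>R v)\<rfloor>)"
  have "\<exists>r. r \<in> S \<and> (\<forall>r'. r' \<in> S \<longrightarrow> m r \<le> m r')"
    by (rule ex_has_least_nat[of _ 1]) (use assms in \<open>simp add: S_def\<close>)
  then obtain r where r: "0 < r" "r \<le> 1" "r *\<^sub>R v \<in> int_lattice" and min: "\<And>r'. r' \<in> S \<Longrightarrow> m r \<le> m r'"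
    by (auto simp: S_def)
  have "x = 0 \<or> x = r *\<^sub>R v" if x: "x \<in> closed_segment 0 (r *\<^sub>R v)" "x \<in> int_lattice" for x
  proof (rule ccontr)
    assume ne: "\<not> (x = 0 \<or> x = r *\<^sub>R v)"
    from x obtain s where s: "0 \<le> s" "s \<le> 1" "x = (s * r) *\<^sub>R v"
      by (auto simp: closed_segment_def)
    with ne have "s \<noteq> 0" "s \<noteq> 1" by auto
    with s have s01: "0 < s" "s < 1" by auto
    have "s * r \<le> 1" using s r by (metis mult_le_one less_imp_le)
    then have "s * r \<in> S" using s01 r x s by (simp add: S_def)
    from min[OF this] have "m r \<le> m (s * r)" .
    moreover have "m (s * r) < m r"
      unfolding m_def
    proof (rule nat_floor_less)
      show "((s * r) *\<^sub>R v) \<bullet> ((s * r) *\<^sub>R v) \<in> \<int>" "(r *\<^sub>R v) \<bullet> (r *\<^sub>R v) \<in> \<int>"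
        using norm_square_Ints r(3) x(2) s(3) by blast+
      have "s * s < 1 * 1" using s01 by (intro mult_strict_mono) auto
      moreover have "0 < r * r * (v \<bullet> v)" using r assms by simp
      ultimately have "(s * s) * (r * r * (v \<bullet> v)) < 1 * (r * r * (v \<bullet> v))"
        by (intro mult_strict_right_mono) auto
      then show "((s * r) *\<^sub>R v) \<bullet> ((s * r) *\<^sub>R v) < (r *\<^sub>R v) \<bullet> (r *\<^sub>R v)"
        by (simp add: algebra_simps)
    qed (rule inner_ge_zero)
    ultimately show False by simp
  qed
  then have "closed_segment 0 (r *\<^sub>R v) \<inter> int_lattice = {0, r *\<^sub>R v}"
    using r by auto
  with r show thesis using that by blast
qed

lemma primitive_segment_translate:
  fixes a u :: "real ^ 'n"
  assumes "closed_segment 0 u \<inter> int_lattice = {0, u}" "u \<noteq> 0" "a \<in> int_lattice"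
  shows "primitive_segment (closed_segment a (a + u))"
  unfolding primitive_segment_def
proof (rule exI[of _ a], rule exI[of _ "a + u"], intro conjI)
  have "u \<in> int_lattice" using assms(1) by blast
  then show "a + u \<in> int_lattice" using assms(3) int_lattice_add by blast
  have seg: "x \<in> closed_segment a (a + u) \<longleftrightarrow> x - a \<in> closed_segment 0 u" for x
    using closed_segment_translation_eq[of a "x - a" 0 u] by simp
  have lat: "x \<in> int_lattice \<longleftrightarrow> x - a \<in> int_lattice" for x
    using int_lattice_add[of "x - a" a] int_lattice_diff[of x a] assms(3) by auto
  show "closed_segment a (a + u) \<inter> int_lattice = {a, a + u}"
  proof (intro set_eqI)
    fix x
    have "x \<in> closed_segment a (a + u) \<inter> int_lattice \<longleftrightarrow> x - a \<in> closed_segment 0 u \<inter> int_lattice"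
      using seg lat by auto
    then show "x \<in> closed_segment a (a + u) \<inter> int_lattice \<longleftrightarrow> x \<in> {a, a + u}"
      unfolding assms(1) by (auto simp: algebra_simps)
  qed
qed (use assms in auto)

section \<open>Sums of primitive segments and zonotopes\<close>

definition fits :: "(real ^ 'n) set \<Rightarrow> nat \<Rightarrow> bool" where
  "fits P L \<longleftrightarrow> (\<exists>E :: nat \<Rightarrow> (real ^ 'n) set. (\<forall>i<L. primitive_segment (E i)) \<and> (\<Sum>i<L. E i) \<subseteq> P)"

text \<open>Each segment is written from the endpoint that makes its direction lexicographically
  positive; the base point of the zonotope is the sum of these endpoints.\<close>

lemma fits_imp_config:
  assumes "fits P L"
  obtains z v where "config P L z v"
proof -
  obtain E where E: "\<forall>i<L. primitive_segment (E i)" "(\<Sum>i<L. E i) \<subseteq> P"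
    using assms unfolding fits_def by blast
  have "\<exists>a u. a \<in> int_lattice \<and> u \<in> int_lattice \<and> lexpos u \<and> E i = closed_segment a (a + u)" if "i < L" for i
  proof -
    have "primitive_segment (E i)" using E(1) that by blast
    then obtain a b where ab: "a \<in> int_lattice" "b \<in> int_lattice" "a \<noteq> b" "E i = closed_segment a b"
      unfolding primitive_segment_def by blast
    from ab(3) have "lexpos (b - a) \<or> lexpos (a - b)" using lexpos_cases[of "b - a"] by simp
    then show ?thesis
    proof
      assume "lexpos (b - a)"
      then show ?thesis using ab by (intro exI[of _ a] exI[of _ "b - a"]) (simp add: int_lattice_diff)
    next
      assume "lexpos (a - b)"
      then show ?thesis using ab
        by (intro exI[of _ b] exI[of _ "a - b"]) (simp add: int_lattice_diff closed_segment_commute)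
    qed
  qed
  then obtain a u where au: "\<And>i. i < L \<Longrightarrow> a i \<in> int_lattice" "\<And>i. i < L \<Longrightarrow> u i \<in> int_lattice"
    "\<And>i. i < L \<Longrightarrow> lexpos (u i)" "\<And>i. i < L \<Longrightarrow> E i = closed_segment (a i) (a i + u i)"
    by metis
  have "zonotope_in P {..<L} (\<Sum>i<L. a i) u"
    unfolding zonotope_in_def
  proof (intro allI impI)
    fix t :: "nat \<Rightarrow> real" assume t: "\<forall>i\<in>{..<L}. 0 \<le> t i \<and> t i \<le> 1"
    have "a i + t i *\<^sub>R u i \<in> E i" if "i < L" for i
      using t that unfolding au(4)[OF that] closed_segment_def
      by (auto intro!: exI[of _ "t i"] simp: algebra_simps)
    then have "(\<Sum>i<L. a i + t i *\<^sub>R u i) \<in> (\<Sum>i<L. E i)"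
      by (subst set_sum_alt) auto
    then show "(\<Sum>i<L. a i) + (\<Sum>i<L. t i *\<^sub>R u i) \<in> P" using E(2) by (auto simp: sum.distrib)
  qed
  with au show thesis
    by (intro that[of "\<Sum>i<L. a i" u]) (auto simp: config_def intro!: int_lattice_sum)
qed


text \<open>Shortening each segment to a primitive one keeps the sum inside
  \<open>P\<close>.\<close>

lemma zonotope_imp_fits:
  assumes "zonotope_in P {..<L} z v" "z \<in> int_lattice"
    and v: "\<And>i. i < L \<Longrightarrow> v i \<in> int_lattice" "\<And>i. i < L \<Longrightarrow> v i \<noteq> 0" and L: "L > 0"
  shows "fits P L"
proof -
  have "\<exists>r. 0 < r \<and> r \<le> 1 \<and> closed_segment 0 (r *\<^sub>R v i) \<inter> int_lattice = {0, r *\<^sub>R v i}" if "i < L" for i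
    using primitive_in_segment[OF v(1)[OF that] v(2)[OF that]] by metis
  then obtain r where r: "\<And>i. i < L \<Longrightarrow> 0 < r i \<and> r i \<le> 1"
    "\<And>i. i < L \<Longrightarrow> closed_segment 0 (r i *\<^sub>R v i) \<inter> int_lattice = {0, r i *\<^sub>R v i}"
    by metis
  \<comment> \<open>The whole translation by \<open>z\<close> is put on the first segment, which
    exists because \<open>L > 0\<close>.\<close>
  define a where "a = (\<lambda>i::nat. if i = 0 then z else 0)"
  have a: "(\<Sum>i<L. a i) = z" using L by (simp add: a_def sum.delta)
  define E where "E = (\<lambda>i. closed_segment (a i) (a i + r i *\<^sub>R v i))"
  have "primitive_segment (E i)" if "i < L" for i
    unfolding E_def using r[OF that] v(2)[OF that] assms(2)
    by (intro primitive_segment_translate) (auto simp: a_def)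
  moreover have "(\<Sum>i<L. E i) \<subseteq> P"
  proof
    fix x assume "x \<in> (\<Sum>i<L. E i)"
    then obtain s where x: "x = (\<Sum>i<L. s i)" and s: "\<And>i. i < L \<Longrightarrow> s i \<in> E i"
      by (auto simp: set_sum_alt)
    have "\<exists>t. 0 \<le> t \<and> t \<le> 1 \<and> s i = a i + t *\<^sub>R (r i *\<^sub>R v i)" if "i < L" for i
      using s[OF that] unfolding E_def closed_segment_def by (auto simp: algebra_simps)
    then obtain t where t: "\<And>i. i < L \<Longrightarrow> 0 \<le> t i \<and> t i \<le> 1"
      "\<And>i. i < L \<Longrightarrow> s i = a i + t i *\<^sub>R (r i *\<^sub>R v i)"
      by metis
    have "x = z + (\<Sum>i<L. (t i * r i) *\<^sub>R v i)"
      unfolding x a[symmetric] sum.distrib[symmetric] by (intro sum.cong) (auto simp: t)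
    also have "\<dots> \<in> P"
      using t r by (intro assms(1)[unfolded zonotope_in_def, rule_format])
        (auto intro!: mult_le_one simp: less_imp_le)
    finally show "x \<in> P" .
  qed
  ultimately show ?thesis unfolding fits_def by blast
qed

text \<open>The segment [0, n u] is the sum of n copies of [0, u]. The copies are the pairs in
  \<open>I\<close>, and \<open>h\<close> numbers them.\<close>

lemma zonotope_ungroup:
  fixes k :: nat and n :: "nat \<Rightarrow> nat"
  assumes "zonotope_in P {..<k} z (\<lambda>j. real (n j) *\<^sub>R u j)" "L = (\<Sum>j<k. n j)"
  obtains g where "\<And>i. i < L \<Longrightarrow> g i < k \<and> n (g i) > 0" "zonotope_in P {..<L} z (\<lambda>i. u (g i))"
proof -
  define I where "I = (SIGMA j:{..<k}. {..<n j})"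
  have "finite I" "card I = L" by (auto simp: I_def assms(2))
  then obtain h where h: "bij_betw h {..<L} I"
    using ex_bij_betw_nat_finite[of I] by (auto simp: atLeast0LessThan)
  show thesis
  proof (rule that[of "\<lambda>i. fst (h i)"])
    fix i assume "i < L"
    then have "h i \<in> I" using h by (auto simp: bij_betw_def)
    then show "fst (h i) < k \<and> n (fst (h i)) > 0" by (auto simp: I_def)
  next
    show "zonotope_in P {..<L} z (\<lambda>i. u (fst (h i)))"
      unfolding zonotope_in_def
    proof (intro allI impI)
      fix t :: "nat \<Rightarrow> real" assume t: "\<forall>i\<in>{..<L}. 0 \<le> t i \<and> t i \<le> 1"
      define t' where "t' = (\<lambda>p. t (inv_into {..<L} h p))"
      have t': "0 \<le> t' p \<and> t' p \<le> 1" if "p \<in> I" for p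
        using t bij_betw_inv_into[OF h] that by (auto simp: t'_def bij_betw_def)
      \<comment> \<open>The mean coefficient over the copies of direction \<open>j\<close>. For
        \<open>n j = 0\<close> division by zero gives 0, in agreement with the empty sum.\<close>
      define T where "T = (\<lambda>j. (\<Sum>m<n j. t' (j, m)) / real (n j))"
      have T: "T j * real (n j) = (\<Sum>m<n j. t' (j, m))" for j
        by (cases "n j = 0") (auto simp: T_def)
      have T01: "0 \<le> T j \<and> T j \<le> 1" if "j < k" for j
      proof
        show "0 \<le> T j" using t' that by (auto simp: T_def I_def intro!: divide_nonneg_nonneg sum_nonneg)
        have "(\<Sum>m<n j. t' (j, m)) \<le> (\<Sum>m<n j. 1)"
          using t' that by (intro sum_mono) (auto simp: I_def)
        then show "T j \<le> 1" by (cases "n j = 0") (auto simp: T_def field_simps)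
      qed
      have "(\<Sum>i<L. t i *\<^sub>R u (fst (h i))) = (\<Sum>i<L. t' (h i) *\<^sub>R u (fst (h i)))"
        using h by (intro sum.cong) (auto simp: t'_def bij_betw_def inv_into_f_f)
      also have "\<dots> = (\<Sum>p\<in>I. t' p *\<^sub>R u (fst p))"
        by (rule sum.reindex_bij_betw[OF h])
      also have "\<dots> = (\<Sum>j<k. \<Sum>m<n j. t' (j, m) *\<^sub>R u j)"
        unfolding I_def by (subst sum.Sigma) (auto simp: case_prod_beta)
      also have "\<dots> = (\<Sum>j<k. T j *\<^sub>R (real (n j) *\<^sub>R u j))"
        by (intro sum.cong refl) (simp add: T scaleR_sum_left)
      finally have eq: "(\<Sum>i<L. t i *\<^sub>R u (fst (h i))) = (\<Sum>j<k. T j *\<^sub>R (real (n j) *\<^sub>R u j))" .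
      show "z + (\<Sum>i<L. t i *\<^sub>R u (fst (h i))) \<in> P"
        unfolding eq using assms(1) T01 unfolding zonotope_in_def by blast
    qed
  qed
qed

section \<open>Counts found by the search and the Minkowski length\<close>

lemma vals_iff:
  "x \<in> vals pts k w z c \<longleftrightarrow> (\<exists>b n. (\<forall>j<k. b j < length pts \<and> n j < length pts) \<and>
     x = c + (\<Sum>j<k. int (n j) * (if pts ! b j = z then 0 else 1)) \<and>
     allin (set pts) 8 (\<lambda>j. if j < k then real (n j) *\<^sub>R (pts ! b j - z) else w j) z)"
proof (induction k arbitrary: w c)
  case 0
  then show ?case by auto
next
  case (Suc k)
  let ?inc = "\<lambda>b. if pts ! b = z then 0 else 1 :: int"
  let ?w = "\<lambda>k b n w j. if j < k then real (n j) *\<^sub>R (pts ! b j - z) else w j"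
  \<comment> \<open>Fixing direction \<open>k\<close> in \<open>w\<close> and then choosing the
    lower ones is the same as extending the choice functions by their values at
    \<open>k\<close>.\<close>
  have eq: "?w k b n (w(k := real m *\<^sub>R (pts ! a - z))) = ?w (Suc k) (b(k := a)) (n(k := m)) w" for b n a m
    by (auto simp: fun_eq_iff less_Suc_eq)
  have "x \<in> vals pts (Suc k) w z c \<longleftrightarrow> (\<exists>a<length pts. \<exists>m<length pts. \<exists>b n.
     (\<forall>j<k. b j < length pts \<and> n j < length pts) \<and>
     x = c + int m * ?inc a + (\<Sum>j<k. int (n j) * ?inc (b j)) \<and>
     allin (set pts) 8 (?w (Suc k) (b(k := a)) (n(k := m)) w) z)" (is "_ \<longleftrightarrow> ?L")
    unfolding vals.simps UN_iff Suc.IH eq by blast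
  also have "\<dots> \<longleftrightarrow> (\<exists>b n. (\<forall>j<Suc k. b j < length pts \<and> n j < length pts) \<and>
     x = c + (\<Sum>j<Suc k. int (n j) * ?inc (b j)) \<and> allin (set pts) 8 (?w (Suc k) b n w) z)" (is "_ \<longleftrightarrow> ?R")
  proof
    assume ?L
    then obtain a m b n where *: "a < length pts" "m < length pts" "\<forall>j<k. b j < length pts \<and> n j < length pts"
      "x = c + int m * ?inc a + (\<Sum>j<k. int (n j) * ?inc (b j))"
      "allin (set pts) 8 (?w (Suc k) (b(k := a)) (n(k := m)) w) z" by blast
    have "(\<Sum>j<k. int ((n(k := m)) j) * ?inc ((b(k := a)) j)) = (\<Sum>j<k. int (n j) * ?inc (b j))"
      by (rule sum.cong) auto
    then have "x = c + (\<Sum>j<Suc k. int ((n(k := m)) j) * ?inc ((b(k := a)) j))"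
      using *(4) by simp
    with *(1-3,5) show ?R
      by (intro exI[of _ "b(k := a)"] exI[of _ "n(k := m)"]) (auto simp del: sum.lessThan_Suc simp: less_Suc_eq)
  next
    assume ?R
    then obtain b n where *: "\<forall>j<Suc k. b j < length pts \<and> n j < length pts"
     "x = c + (\<Sum>j<Suc k. int (n j) * ?inc (b j))" "allin (set pts) 8 (?w (Suc k) b n w) z" by blast
    then have "b k < length pts" "n k < length pts" "\<forall>j<k. b j < length pts \<and> n j < length pts"
      "x = c + int (n k) * ?inc (b k) + (\<Sum>j<k. int (n j) * ?inc (b j))"
      "allin (set pts) 8 (?w (Suc k) (b(k := b k)) (n(k := n k)) w) z"
      by (simp_all only: fun_upd_triv sum.lessThan_Suc) (simp_all add: less_Suc_eq)
    then show ?L by blast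
  qed
  finally show ?case .
qed

text \<open>Completeness of the search. The points \<open>z + real m *\<^sub>R u j\<close> with m
  \<le> n_j lie in \<open>P\<close>; m = 0 and m = 1 provide z and p_j as list entries, and counting
  all of them bounds n_j.\<close>

lemma fits_imp_vals:
  assumes "fits P L" and pts: "set pts = P \<inter> int_lattice"
  shows "int L \<in> (\<Union>i<length pts. vals pts 8 (\<lambda>_. 0) (pts ! i) 0)"
proof -
  obtain z0 v0 where c: "config P L z0 v0" using fits_imp_config[OF assms(1)] .
  obtain z and n :: "nat \<Rightarrow> nat" and u where z: "z \<in> int_lattice" and L: "(\<Sum>j<8. n j) = L"
    and u: "\<And>j. j < 8 \<Longrightarrow> u j \<in> int_lattice" "\<And>j. j < 8 \<Longrightarrow> n j > 0 \<Longrightarrow> u j \<noteq> 0"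
    and zon: "zonotope_in P {..<8} z (\<lambda>j. real (n j) *\<^sub>R u j)"
  proof (rule config_8_directions[OF c], goal_cases)
    case 1
    show ?case by (rule 1(1)[OF 1(2-6)])
  qed
  have step: "z + real m *\<^sub>R u j \<in> set pts" if "j < 8" "m \<le> n j" for j m
  proof -
    \<comment> \<open>Only direction \<open>j\<close> is used. If \<open>n j = 0\<close>, then
      \<open>m = 0\<close> and the quotient is 0 as well.\<close>
    define t where "t = (\<lambda>i. if i = j then real m / real (n j) else 0)"
    have "\<forall>i. 0 \<le> t i \<and> t i \<le> 1" using that by (auto simp: t_def divide_le_eq)
    then have "z + (\<Sum>i<8. t i *\<^sub>R (real (n i) *\<^sub>R u i)) \<in> P"
      using zon unfolding zonotope_in_def by blast
    also have "(\<Sum>i<8. t i *\<^sub>R (real (n i) *\<^sub>R u i)) = (\<Sum>i<8. if i = j then real m *\<^sub>R u j else 0)"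
      using that by (intro sum.cong) (auto simp: t_def)
    finally have "z + real m *\<^sub>R u j \<in> P" using that by (simp add: sum.delta)
    then show ?thesis unfolding pts using z u that by (simp add: int_lattice_add int_lattice_scale)
  qed
  have n: "n j < length pts" if "j < 8" for j
  proof (cases "n j = 0")
    case True
    then show ?thesis using step[of j 0] that by (cases pts) auto
  next
    case False
    then have "inj_on (\<lambda>m. z + real m *\<^sub>R u j) {..n j}"
      using u that by (auto simp: inj_on_def)
    then have "card {..n j} \<le> card (set pts)"
      using step that by (intro card_inj_on_le) auto
    then show ?thesis using card_length[of pts] by simp
  qed
  have "z \<in> set pts" using step[of 0 0] by simp
  then obtain i where i: "i < length pts" "pts ! i = z" by (auto simp: in_set_conv_nth)
  \<comment> \<open>For \<open>n j = 0\<close> the point \<open>z + u j\<close> need not lie in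
    \<open>P\<close>, so z itself is chosen; such a direction adds 0 to the count.\<close>
  have "\<exists>b<length pts. pts ! b = (if n j = 0 then z else z + u j)" if "j < 8" for j
    using step[OF that, of 1] i by (cases "n j = 0") (auto simp: in_set_conv_nth)
  then obtain b where b: "\<And>j. j < 8 \<Longrightarrow> b j < length pts"
      "\<And>j. j < 8 \<Longrightarrow> pts ! b j = (if n j = 0 then z else z + u j)"
    by metis
  have "(\<Sum>j<8. int (n j) * (if pts ! b j = z then 0 else 1)) = (\<Sum>j<8. int (n j))"
    using b u by (intro sum.cong) auto
  also have "\<dots> = int L" by (simp add: L[symmetric])
  finally have sum: "int L = 0 + (\<Sum>j<8. int (n j) * (if pts ! b j = z then 0 else 1))" by simp
  have "allin (set pts) 8 (\<lambda>j. real (n j) *\<^sub>R u j) z"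
    unfolding pts using u z by (intro zonotope_in_imp_allin[OF zon]) (auto intro: int_lattice_scale)
  also have "?this \<longleftrightarrow> allin (set pts) 8
      (\<lambda>j. if j < 8 then real (n j) *\<^sub>R (pts ! b j - z) else 0) z"
    using b by (intro allin_cong) auto
  finally have all: "allin (set pts) 8
      (\<lambda>j. if j < 8 then real (n j) *\<^sub>R (pts ! b j - z) else 0) z" .
  have "int L \<in> vals pts 8 (\<lambda>_. 0) z 0"
    unfolding vals_iff
  proof (rule exI[of _ b], rule exI[of _ n], intro conjI allI impI)
    show "int L = 0 + (\<Sum>j<8. int (n j) * (if pts ! b j = z then 0 else 1))" by (fact sum)
    show "allin (set pts) 8 (\<lambda>j. if j < 8 then real (n j) *\<^sub>R (pts ! b j - z) else 0) z" by (fact all)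
  qed (fact b(1) n)+
  with i show "int L \<in> (\<Union>i<length pts. vals pts 8 (\<lambda>_. 0) (pts ! i) 0)" by auto
qed

text \<open>Soundness of the search: ungrouping a hit gives as many non-zero lattice directions as
  were counted. The case \<open>L = 0\<close> stands apart because \<open>fits P 0\<close> would
  demand that 0 lies in \<open>P\<close>.\<close>

lemma vals_imp_fits:
  assumes x: "x \<in> vals pts 8 w (pts ! i) 0" and i: "i < length pts"
    and P: "convex P" and pts: "set pts = P \<inter> int_lattice"
  shows "\<exists>L. x = int L \<and> (L = 0 \<or> fits P L)"
proof -
  define z where "z = pts ! i"
  obtain b n where b: "\<And>j. j < 8 \<Longrightarrow> b j < length pts"
    and sum: "x = (\<Sum>j<8. int (n j) * (if pts ! b j = z then 0 else 1))"
    and all: "allin (set pts) 8 (\<lambda>j. if j < 8 then real (n j) *\<^sub>R (pts ! b j - z) else w j) z"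
    using x unfolding vals_iff z_def[symmetric] add_0_left by blast
  \<comment> \<open>Directions with p_j = z get multiplicity 0. Their vectors are 0 anyway, so the
    zonotope does not change.\<close>
  define m where "m = (\<lambda>j. n j * (if pts ! b j = z then 0 else 1))"
  define L where "L = (\<Sum>j<8. m j)"
  have xL: "x = int L" unfolding sum L_def m_def of_nat_sum by (intro sum.cong) auto
  have lat: "y \<in> int_lattice" if "y \<in> set pts" for y using that pts by auto
  have "allin (set pts) 8 (\<lambda>j. real (m j) *\<^sub>R (pts ! b j - z)) z"
    using all by (rule back_subst) (rule allin_cong, auto simp: m_def)
  then have zon: "zonotope_in P {..<8} z (\<lambda>j. real (m j) *\<^sub>R (pts ! b j - z))"
    by (rule allin_imp_zonotope_in[OF P]) (use pts in auto)
  obtain g where g: "\<And>l. l < L \<Longrightarrow> g l < 8 \<and> m (g l) > 0"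
    "zonotope_in P {..<L} z (\<lambda>l. pts ! b (g l) - z)"
    using zonotope_ungroup[where u = "\<lambda>j. pts ! b j - z", OF zon L_def] by blast
  have "fits P L" if "L > 0"
  proof (rule zonotope_imp_fits[OF g(2) _ _ _ that])
    show "z \<in> int_lattice" using i lat by (simp add: z_def)
    fix l assume "l < L"
    then have "g l < 8" "m (g l) > 0" using g(1) by blast+
    then have "b (g l) < length pts" "pts ! b (g l) \<noteq> z"
      using b by (auto simp: m_def split: if_splits)
    then show "pts ! b (g l) - z \<in> int_lattice" "pts ! b (g l) - z \<noteq> 0"
      using i lat by (auto simp: z_def intro!: int_lattice_diff)
  qed
  with xL show ?thesis by auto
qed

text \<open>By soundness the value found is attained; by completeness it bounds all attainable
  lengths, which also ensures that the \<open>GREATEST\<close> in the definition exists.\<close>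

lemma minkowski_length_eq:
  assumes "convex P" and pts: "set pts = P \<inter> int_lattice"
    and b: "upd 0 (\<Union>i<length pts. vals pts 8 (\<lambda>_. 0) (pts ! i) 0) b"
  shows "b = int (minkowski_length P)"
proof -
  define V where "V = (\<lambda>i. vals pts 8 (\<lambda>_. 0) (pts ! i) 0)"
  have b: "b \<in> insert 0 (\<Union>i<length pts. V i)" "\<And>x. x \<in> insert 0 (\<Union>i<length pts. V i) \<Longrightarrow> x \<le> b"
    using b unfolding upd_def V_def by blast+
  have "\<exists>L. b = int L \<and> (L = 0 \<or> fits P L)"
  proof (cases "b = 0")
    case False
    with b obtain i where "i < length pts" "b \<in> V i" by blast
    then show ?thesis unfolding V_def using vals_imp_fits[OF _ _ assms(1) pts] by blast
  qed simp
  then obtain L where L: "b = int L" "L = 0 \<or> fits P L" by blast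
  have "minkowski_length P = L"
    unfolding minkowski_length_def fits_def[symmetric]
  proof (rule Greatest_equality[of "\<lambda>L. L = 0 \<or> fits P L", OF L(2)])
    fix M assume "M = 0 \<or> fits P M"
    then show "M \<le> L"
      using fits_imp_vals[OF _ pts, folded V_def] b(2)[of "int M"] L(1) by auto
  qed
  with L show ?thesis by simp
qed

theorem theorem2p7:
  shows "\<exists>(prog :: instr list) (q :: nat poly).
    \<forall>(P :: (real ^ 3) set) (pts :: (real ^ 3) list).
      lattice_polytope P \<longrightarrow> distinct pts \<longrightarrow> set pts = P \<inter> int_lattice \<longrightarrow>
      ram_computes_within prog (encode_points pts) [int (minkowski_length P)]
        (poly q (card (P \<inter> int_lattice)))"
proof -
  obtain q where q: "\<And>n. total_time n = poly q n"
    using poly_bounded_total_time unfolding poly_bounded_def by blast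
  have "ram_computes_within (compile minkowski_prog 0) (encode_points pts) [int (minkowski_length P)]
      (poly q (card (P \<inter> int_lattice)))"
    if P: "lattice_polytope P" and pts: "distinct pts" "set pts = P \<inter> int_lattice"
    for P :: "(real ^ 3) set" and pts
  proof -
    obtain S where S: "S \<noteq> {}" "S \<subseteq> int_lattice" "P = convex hull S"
      using P unfolding lattice_polytope_def by blast
    then have "P \<inter> int_lattice \<noteq> {}" using hull_subset[of S convex] by blast
    then have ne: "pts \<noteq> []" using pts(2) by auto
    have lat: "set pts \<subseteq> int_lattice" using pts(2) by blast
    have conv: "convex P" by (simp add: S(3) convex_convex_hull)
    \<comment> \<open>Distinctness turns the length of the list, which bounds the time, into the
      number of lattice points.\<close>
    have "poly q (card (P \<inter> int_lattice)) = total_time (length pts)"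
      using distinct_card[OF pts(1)] by (simp add: q pts(2))
    moreover have "run minkowski_prog (total_time (length pts)) (\<lambda>_. 0, encode_points pts, [])
        (\<lambda>(f, i, p). p = [int (minkowski_length P)])"
      by (rule run_mono[OF run_minkowski_prog[OF ne lat]])
        (use minkowski_length_eq[OF conv pts(2)] in auto)
    ultimately show ?thesis using run_computes by simp
  qed
  then show ?thesis by blast
qed

end
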